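(* 1. The algebra $\operatorname{End}(T_n)$ of all endomorphisms of the $\mathbb{K}[X]$-module $T_n$ is isomorphic to the algebra $\mathbb{K}[[X]]$ of formal power series in $n$ variables. In particular, the automorphism group $\operatorname{Aut}(T_n)$ is isomorphic to the multiplicative group $\mathbb{K}[[X]]^{*}$ of the algebra $\mathbb{K}[[X]]$. 2. The automorphism group of a finite dimensional monomial submodule $M\subset T_n$ of dimension $m\ge 1$ over $\mathbb{K}$ is isomorphic to the direct product $\mathbb{K}^{*}\times(\mathbb{K}^{+})^{m-1}$. 3. The automorphism group of any finite dimensional (over $\mathbb{K}$) $\mathbb{K}[X]$-module $V$ with one dimensional socle (i.e. $\dim_{\mathbb{K}}\operatorname{Soc}(V)=1$) is isomorphic to a quotient group of $\mathbb{K}^{*}\times(\mathbb{K}^{+})^{m}$ for some $m\ge 0$.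
   Context: $\mathbb{K}$ is an algebraically closed field of characteristic zero, $n\ge 1$, $\mathbb{K}[X]:=\mathbb{K}[x_1,\dots,x_n]$ is the polynomial algebra and $\mathbb{K}[[X]]:=\mathbb{K}[[x_1,\dots,x_n]]$ is the algebra of formal power series in $n$ variables. $\mathbb{K}^{*}$ is the multiplicative group and $\mathbb{K}^{+}$ the additive group of $\mathbb{K}$. $T_n$ denotes the $\mathbb{K}[X]$-module whose underlying vector space is $\mathbb{K}[X]$ and on which the generators act by $x_i\cdot f=\frac{\partial f}{\partial x_i}$, $i=1,\dots,n$. For a $\mathbb{K}[X]$-module $V$, $\operatorname{End}(V)$ denotes the $\mathbb{K}$-algebra of all $\mathbb{K}[X]$-module endomorphisms of $V$ and $\operatorname{Aut}(V)$ the group of all $\mathbb{K}[X]$-module automorphisms of $V$. The socle $\operatorname{Soc}(V)$ is the sum of all minimal submodules of $V$. A submodule $M$ of $T_n$ is called monomial if it has a basis over $\mathbb{K}$ consisting of monomials $x_1^{\lambda_1}\cdots x_n^{\lambda_n}$. *)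

theory Defs
  imports
    "HOL-Library.Poly_Mapping"
    "HOL-Algebra.Algebra"
    "HOL-Algebra.Algebraic_Closure_Type"
begin

section \<open>Polynomials, derivatives and power series in finitely many variables\<close>

text \<open>
  The variables are indexed by a finite type \<open>'n\<close>; \<open>CARD('n)\<close> is the number of variables,
  which is automatically at least one.
\<close>

type_synonym 'n mon = "'n \<Rightarrow>\<^sub>0 nat"
type_synonym ('n, 'k) mpol = "'n mon \<Rightarrow>\<^sub>0 'k"

definition Const :: "'k \<Rightarrow> ('n, 'k::zero) mpol" where
  "Const c = Poly_Mapping.single 0 c"

definition monomial :: "'n mon \<Rightarrow> ('n, 'k::zero_neq_one) mpol" where
  "monomial a = Poly_Mapping.single a 1"

definition Var :: "'n \<Rightarrow> ('n, 'k::zero_neq_one) mpol" where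
  "Var i = monomial (Poly_Mapping.single i 1)"

text \<open>
  Subtraction of exponents is truncated; if \<open>x\<^sub>i\<close> does not occur in a monomial, the
  corresponding summand has coefficient \<open>0\<close>.
\<close>

definition pdiff :: "'n \<Rightarrow> ('n, 'k::comm_semiring_1) mpol \<Rightarrow> ('n, 'k) mpol" where
  "pdiff i f = (\<Sum>a\<in>Poly_Mapping.keys f. Poly_Mapping.single (a - Poly_Mapping.single i 1)
      (of_nat (Poly_Mapping.lookup a i) * Poly_Mapping.lookup f a))"

text \<open>
  The composition of the operators \<open>(\<partial>/\<partial>x\<^sub>i) ^ a\<^sub>i\<close> over all variables; they commute
  (lemma \<open>pdiff_commute\<close> below), so the order of composition is immaterial.
\<close>

definition mdiff :: "'n::finite mon \<Rightarrow> ('n, 'k::comm_semiring_1) mpol \<Rightarrow> ('n, 'k) mpol" where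
  "mdiff a f = Finite_Set.fold (\<lambda>i. pdiff i ^^ Poly_Mapping.lookup a i) f UNIV"

text \<open>
  The action of polynomials on the module \<open>T\<^sub>n\<close>: the polynomial \<open>p\<close> acts as the
  constant coefficient differential operator \<open>p(\<partial>/\<partial>x\<^sub>1, \<dots>, \<partial>/\<partial>x\<^sub>n)\<close>.
  The underlying space is the whole type of polynomials.
\<close>

definition Tn :: "('n::finite, 'k::comm_semiring_1) mpol \<Rightarrow> ('n, 'k) mpol \<Rightarrow> ('n, 'k) mpol" where
  "Tn p f = (\<Sum>a\<in>Poly_Mapping.keys p. Const (Poly_Mapping.lookup p a) * mdiff a f)"

text \<open>
  A formal power series is an arbitrary family of coefficients indexed by exponents; the sum in
  the product is finite (lemma \<open>finite_mon_antidiagonal\<close>).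
\<close>

definition mps_algebra :: "('k::comm_ring_1, 'n::finite mon \<Rightarrow> 'k) module" where
  "mps_algebra =
    \<lparr>carrier = UNIV,
     monoid.mult = (\<lambda>f g c. \<Sum>(a, b)\<in>{(a, b). a + b = c}. f a * g b),
     one = (\<lambda>c. if c = 0 then 1 else 0),
     ring.zero = (\<lambda>_. 0),
     add = (\<lambda>f g c. f c + g c),
     module.smult = (\<lambda>k f c. k * f c)\<rparr>"


section \<open>Submodules, endomorphisms and automorphisms\<close>

text \<open>
  A module over a commutative ring \<open>'r\<close> is given by its scalar multiplication
  \<open>s :: 'r \<Rightarrow> 'm \<Rightarrow> 'm\<close> on a type \<open>'m\<close> (locale \<^locale>\<open>Modules.module\<close>); its submodules
  are the sets satisfying \<^const>\<open>Modules.module.subspace\<close>. Maps between submodules are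
  extensional functions, as in \<^const>\<open>Bij\<close>.
\<close>

definition mod_End :: "('r \<Rightarrow> 'm::ab_group_add \<Rightarrow> 'm) \<Rightarrow> 'm set \<Rightarrow> ('m \<Rightarrow> 'm) set" where
  "mod_End s W = {f \<in> W \<rightarrow>\<^sub>E W.
      (\<forall>x\<in>W. \<forall>y\<in>W. f (x + y) = f x + f y) \<and> (\<forall>r. \<forall>x\<in>W. f (s r x) = s r (f x))}"

definition mod_AutGroup :: "('r \<Rightarrow> 'm::ab_group_add \<Rightarrow> 'm) \<Rightarrow> 'm set \<Rightarrow> ('m \<Rightarrow> 'm) monoid" where
  "mod_AutGroup s W = BijGroup W\<lparr>carrier := mod_End s W \<inter> Bij W\<rparr>"

definition minimal_submodule :: "('r::comm_ring_1 \<Rightarrow> 'm::ab_group_add \<Rightarrow> 'm) \<Rightarrow> 'm set \<Rightarrow> bool" where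
  "minimal_submodule s N \<longleftrightarrow> Modules.module.subspace s N \<and> N \<noteq> {0} \<and>
      (\<forall>N'. Modules.module.subspace s N' \<and> N' \<subseteq> N \<longrightarrow> N' = {0} \<or> N' = N)"

definition Soc :: "('r::comm_ring_1 \<Rightarrow> 'm::ab_group_add \<Rightarrow> 'm) \<Rightarrow> 'm set" where
  "Soc s = Modules.module.span s (\<Union>{N. minimal_submodule s N})"

text \<open>The vector space over the ground field underlying a module over the polynomial ring.\<close>

definition kscale :: "(('n, 'k::comm_ring_1) mpol \<Rightarrow> 'm \<Rightarrow> 'm) \<Rightarrow> 'k \<Rightarrow> 'm \<Rightarrow> 'm" where
  "kscale s c = s (Const c)"

definition fin_dim :: "(('n, 'k::field) mpol \<Rightarrow> 'm::ab_group_add \<Rightarrow> 'm) \<Rightarrow> 'm set \<Rightarrow> bool" where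
  "fin_dim s W \<longleftrightarrow> (\<exists>B. finite B \<and> Modules.module.span (kscale s) B = W)"

definition kdim :: "(('n, 'k::field) mpol \<Rightarrow> 'm::ab_group_add \<Rightarrow> 'm) \<Rightarrow> 'm set \<Rightarrow> nat" where
  "kdim s W = vector_space.dim (kscale s) W"

definition monomial_submodule :: "('n::finite, 'k::field) mpol set \<Rightarrow> bool" where
  "monomial_submodule M \<longleftrightarrow> Modules.module.subspace Tn M \<and>
      (\<exists>B \<subseteq> range monomial.
         \<not> Modules.module.dependent (kscale Tn) B \<and> Modules.module.span (kscale Tn) B = M)"

definition mod_End_algebra ::
    "(('n, 'k::comm_ring_1) mpol \<Rightarrow> 'm::ab_group_add \<Rightarrow> 'm) \<Rightarrow> 'm set \<Rightarrow> ('k, 'm \<Rightarrow> 'm) module" where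
  "mod_End_algebra s W =
    \<lparr>carrier = mod_End s W,
     monoid.mult = (\<lambda>f g. compose W f g),
     one = (\<lambda>x\<in>W. x),
     ring.zero = (\<lambda>x\<in>W. 0),
     add = (\<lambda>f g. \<lambda>x\<in>W. f x + g x),
     module.smult = (\<lambda>c f. \<lambda>x\<in>W. kscale s c (f x))\<rparr>"

definition alg_isomorphic :: "('k, 'a) module \<Rightarrow> ('k, 'b) module \<Rightarrow> bool" where
  "alg_isomorphic A B \<longleftrightarrow> (\<exists>h \<in> ring_iso A B.
      \<forall>c. \<forall>a \<in> carrier A. h (c \<odot>\<^bsub>A\<^esub> a) = c \<odot>\<^bsub>B\<^esub> h a)"


section \<open>The multiplicative and the additive group of the ground field\<close>

definition mult_grp :: "'k::field monoid" where
  "mult_grp = units_of ring_of_type_algebra"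

definition add_grp :: "'k::field monoid" where
  "add_grp = add_monoid ring_of_type_algebra"

definition K_grp :: "nat \<Rightarrow> ('k::field \<times> (nat \<Rightarrow> 'k)) monoid" where
  "K_grp m = mult_grp \<times>\<times> product_group {..<m} (\<lambda>_. add_grp)"


section \<open>Basic facts\<close>

lemma finite_mon_antidiagonal: "finite {(a, b). a + b = (c :: 'n::finite mon)}"
proof -
  let ?A = "{a :: 'n mon. \<forall>i. Poly_Mapping.lookup a i \<le> Poly_Mapping.lookup c i}"
  have inj: "inj_on Poly_Mapping.lookup ?A"
    by (rule inj_onI) (simp only: poly_mapping_eq_iff)
  have "Poly_Mapping.lookup ` ?A \<subseteq> Pi\<^sub>E UNIV (\<lambda>i. {..Poly_Mapping.lookup c i})"
    by (rule image_subsetI) (simp add: PiE_UNIV_domain)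
  then have "finite (Poly_Mapping.lookup ` ?A)"
    by (rule finite_subset) (rule finite_PiE, simp_all)
  then have fin: "finite ?A"
    using inj by (rule finite_imageD)
  have "{(a, b). a + b = c} \<subseteq> ?A \<times> ?A"
  proof (rule subsetI)
    fix z assume "z \<in> {(a, b). a + b = c}"
    then obtain a b where "z = (a, b)" "a + b = c" by (cases z) simp
    then show "z \<in> ?A \<times> ?A" by (simp add: lookup_add flip: \<open>a + b = c\<close>)
  qed
  then show ?thesis
    by (rule finite_subset) (rule finite_cartesian_product[OF fin fin])
qed

lemma algebra_mps_algebra:
  "algebra (ring_of_type_algebra :: 'k ring)
     (mps_algebra :: ('k::comm_ring_1, 'n::finite mon \<Rightarrow> 'k) module)"
proof -
  let ?S = "\<lambda>c :: 'n mon. {(a, b). a + b = c}"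
  let ?m = "\<lambda>(f :: 'n mon \<Rightarrow> 'k) g c. \<Sum>(a, b)\<in>?S c. f a * g b"
  have comm: "?m f g = ?m g f" for f g
  proof
    fix c
    show "?m f g c = ?m g f c"
      by (rule sum.reindex_bij_witness[of _ prod.swap prod.swap]) (auto simp: ac_simps)
  qed
  have assoc: "?m (?m f g) h = ?m f (?m g h)" for f g h
  proof
    fix c
    have "?m (?m f g) h c = (\<Sum>z\<in>?S c. \<Sum>w\<in>?S (fst z). f (fst w) * g (snd w) * h (snd z))"
      by (simp add: case_prod_beta sum_distrib_right)
    also have "\<dots> = (\<Sum>(z, w)\<in>Sigma (?S c) (\<lambda>z. ?S (fst z)). f (fst w) * g (snd w) * h (snd z))"
      by (rule sum.Sigma) (simp_all add: finite_mon_antidiagonal)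
    also have "\<dots> = (\<Sum>(z, w)\<in>Sigma (?S c) (\<lambda>z. ?S (snd z)). f (fst z) * (g (fst w) * h (snd w)))"
      by (rule sum.reindex_bij_witness[of _
            "\<lambda>(z, w). ((fst z + fst w, snd w), (fst z, fst w))"
            "\<lambda>(z, w). ((fst w, snd w + snd z), (snd w, snd z))"])
         (auto simp: add.assoc mult.assoc)
    also have "\<dots> = (\<Sum>z\<in>?S c. \<Sum>w\<in>?S (snd z). f (fst z) * (g (fst w) * h (snd w)))"
      by (rule sum.Sigma[symmetric]) (simp_all add: finite_mon_antidiagonal)
    also have "\<dots> = ?m f (?m g h) c"
      by (simp add: case_prod_beta sum_distrib_left)
    finally show "?m (?m f g) h c = ?m f (?m g h) c" .
  qed
  have one: "?m (\<lambda>c. if c = 0 then 1 else 0) f = f" for f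
  proof
    fix c
    have "?m (\<lambda>c. if c = 0 then 1 else 0) f c = (\<Sum>z\<in>{(0 :: 'n mon, c)}. f (snd z))"
      by (rule sum.mono_neutral_cong_right) (auto simp: finite_mon_antidiagonal split: if_splits)
    then show "?m (\<lambda>c. if c = 0 then 1 else 0) f c = f c" by simp
  qed
  have distrib: "?m (\<lambda>c. f c + g c) h = (\<lambda>c. ?m f h c + ?m g h c)" for f g h
    by (simp add: case_prod_beta distrib_right sum.distrib)
  have smult: "?m (\<lambda>c. k * f c) g = (\<lambda>c. k * ?m f g c)" for k f g
    by (simp add: case_prod_beta mult.assoc sum_distrib_left)
  have "cring (mps_algebra :: ('k, 'n mon \<Rightarrow> 'k) module)"
  proof (rule cringI)
    show "abelian_group (mps_algebra :: ('k, 'n mon \<Rightarrow> 'k) module)"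
      by (rule abelian_groupI)
         (auto simp: mps_algebra_def fun_eq_iff ac_simps intro: exI[of _ "\<lambda>c. - f c" for f])
    show "comm_monoid (mps_algebra :: ('k, 'n mon \<Rightarrow> 'k) module)"
      by (rule comm_monoidI) (simp_all add: mps_algebra_def assoc one, rule comm)
  qed (simp add: mps_algebra_def distrib)
  then show ?thesis
    by (intro algebraI cring_from_type_algebra)
       (simp_all add: mps_algebra_def ring_of_type_algebra_def smult distrib_left distrib_right
          mult.assoc case_prod_beta sum_distrib_left)
qed

lemma lookup_pdiff:
  "Poly_Mapping.lookup (pdiff i f) b =
     of_nat (Poly_Mapping.lookup b i + 1) * Poly_Mapping.lookup f (b + Poly_Mapping.single i 1)"
proof -
  let ?e = "Poly_Mapping.single i (1::nat)"
  have *: "Poly_Mapping.lookup (Poly_Mapping.single (a - ?e)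
        (of_nat (Poly_Mapping.lookup a i) * Poly_Mapping.lookup f a)) b =
      (if a = b + ?e then of_nat (Poly_Mapping.lookup a i) * Poly_Mapping.lookup f a else 0)" for a
  proof (cases "Poly_Mapping.lookup a i = 0")
    case True
    then have "a \<noteq> b + ?e"
      by (auto simp: lookup_add)
    then show ?thesis using True by simp
  next
    case False
    then have "a - ?e = b \<longleftrightarrow> a = b + ?e"
      by (auto simp: poly_mapping_eq_iff fun_eq_iff lookup_add lookup_minus lookup_single when_def)
    then show ?thesis
      by (auto simp: lookup_single when_def)
  qed
  have "Poly_Mapping.lookup (pdiff i f) b =
      (\<Sum>a\<in>Poly_Mapping.keys f. if a = b + ?e then of_nat (Poly_Mapping.lookup a i) * Poly_Mapping.lookup f a else 0)"
    unfolding pdiff_def lookup_sum by (intro sum.cong refl *)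
  also have "\<dots> = of_nat (Poly_Mapping.lookup b i + 1) * Poly_Mapping.lookup f (b + ?e)"
    by (auto simp: lookup_add in_keys_iff)
  finally show ?thesis .
qed

lemma pdiff_add: "pdiff i (f + g) = pdiff i f + pdiff i g"
  by (rule poly_mapping_eqI) (simp only: lookup_pdiff lookup_add distrib_left)

lemma lookup_Const_times:
  "Poly_Mapping.lookup (Const c * f) b = c * Poly_Mapping.lookup f b"
  for f :: "('n, 'k::comm_semiring_1) mpol"
proof -
  have "Const c * f = Poly_Mapping.map ((*) c) f"
    unfolding Const_def by (simp add: mult_map_scale_conv_mult)
  then show ?thesis
    by (simp add: Poly_Mapping.map.rep_eq when_def)
qed

lemma pdiff_Const_times: "pdiff i (Const c * f) = Const c * pdiff i f"
  by (rule poly_mapping_eqI) (unfold lookup_pdiff lookup_Const_times, rule mult.left_commute)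

lemma pdiff_commute: "pdiff i (pdiff j f) = pdiff j (pdiff i f)"
proof (cases "i = j")
  case False
  then show ?thesis
    by (intro poly_mapping_eqI) (simp add: lookup_pdiff lookup_add lookup_single ac_simps)
qed simp

lemma funpow_commute:
  assumes "\<And>x. f (g x) = g (f x)"
  shows "(f ^^ m) ((g ^^ n) x) = (g ^^ n) ((f ^^ m) x)"
proof -
  have "(f ^^ m) (g x) = g ((f ^^ m) x)" for x m
    by (induction m) (simp_all add: assms)
  then show ?thesis
    by (induction n) simp_all
qed

lemma funpow_pdiff_commute:
  "(pdiff i ^^ m) ((pdiff j ^^ n) f) = (pdiff j ^^ n) ((pdiff i ^^ m) f)"
  by (rule funpow_commute) (rule pdiff_commute)

lemma pdiff_comp_fun_commute:
  "comp_fun_commute (\<lambda>i. pdiff i ^^ e i)"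
  by unfold_locales (simp add: fun_eq_iff, intro allI, rule funpow_pdiff_commute)

lemma mdiff_add: "mdiff a (f + g) = mdiff a f + mdiff a g"
proof -
  have *: "(pdiff i ^^ n) (f + g) = (pdiff i ^^ n) f + (pdiff i ^^ n) g" for i n and f g :: "('a, 'b) mpol"
    by (induction n) (simp_all add: pdiff_add)
  interpret comp_fun_commute "\<lambda>i. pdiff i ^^ Poly_Mapping.lookup a i :: ('a, 'b) mpol \<Rightarrow> _"
    by (rule pdiff_comp_fun_commute)
  have "finite I \<Longrightarrow> Finite_Set.fold (\<lambda>i. pdiff i ^^ Poly_Mapping.lookup a i) (f + g) I =
      Finite_Set.fold (\<lambda>i. pdiff i ^^ Poly_Mapping.lookup a i) f I +
      Finite_Set.fold (\<lambda>i. pdiff i ^^ Poly_Mapping.lookup a i) g I" for I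
    by (induction rule: finite_induct) (simp_all add: *)
  then show ?thesis
    unfolding mdiff_def by simp
qed

lemma mdiff_Const_times: "mdiff a (Const c * f) = Const c * mdiff a f"
proof -
  have *: "(pdiff i ^^ n) (Const c * f) = Const c * (pdiff i ^^ n) f" for i n and f :: "('a, 'b) mpol"
    by (induction n) (simp_all add: pdiff_Const_times)
  interpret comp_fun_commute "\<lambda>i. pdiff i ^^ Poly_Mapping.lookup a i :: ('a, 'b) mpol \<Rightarrow> _"
    by (rule pdiff_comp_fun_commute)
  have "finite I \<Longrightarrow> Finite_Set.fold (\<lambda>i. pdiff i ^^ Poly_Mapping.lookup a i) (Const c * f) I =
      Const c * Finite_Set.fold (\<lambda>i. pdiff i ^^ Poly_Mapping.lookup a i) f I" for I
    by (induction rule: finite_induct) (simp_all add: *)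
  then show ?thesis
    unfolding mdiff_def by simp
qed

lemma mdiff_sum: "mdiff a (sum g A) = (\<Sum>x\<in>A. mdiff a (g x))"
proof -
  have zero: "mdiff a 0 = (0 :: ('a, 'b) mpol)"
    using mdiff_Const_times[of a 0 0] by (simp add: Const_def)
  then show ?thesis
    by (induction A rule: infinite_finite_induct) (simp_all add: mdiff_add)
qed

lemma mdiff_mdiff: "mdiff (a + b) f = mdiff a (mdiff b f)"
proof -
  let ?F = "\<lambda>e :: 'a \<Rightarrow> nat. \<lambda>i. pdiff i ^^ e i :: ('a, 'b) mpol \<Rightarrow> _"
  let ?a = "Poly_Mapping.lookup a" and ?b = "Poly_Mapping.lookup b"
  let ?ab = "\<lambda>i. ?a i + ?b i"
  interpret A: comp_fun_commute "?F ?a" by (rule pdiff_comp_fun_commute)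
  interpret B: comp_fun_commute "?F ?b" by (rule pdiff_comp_fun_commute)
  interpret AB: comp_fun_commute "?F ?ab" by (rule pdiff_comp_fun_commute)
  have comm: "finite I \<Longrightarrow>
      Finite_Set.fold (?F ?a) ((pdiff j ^^ n) g) I = (pdiff j ^^ n) (Finite_Set.fold (?F ?a) g I)" for I j n g
  proof (induction rule: finite_induct)
    case (insert x F)
    show ?case
      unfolding A.fold_insert[OF insert.hyps] insert.IH by (rule funpow_pdiff_commute)
  qed simp
  have "finite I \<Longrightarrow> Finite_Set.fold (?F ?ab) f I =
      Finite_Set.fold (?F ?a) (Finite_Set.fold (?F ?b) f I) I" for I
  proof (induction rule: finite_induct)
    case (insert x F)
    show ?case
      unfolding AB.fold_insert[OF insert.hyps] A.fold_insert[OF insert.hyps]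
        B.fold_insert[OF insert.hyps] insert.IH comm[OF insert.hyps(1)]
      by (simp only: funpow_add o_apply)
  qed simp
  then show ?thesis
    unfolding mdiff_def by (simp add: lookup_add)
qed

lemma mdiff_zero: "mdiff 0 f = f"
proof -
  let ?F = "\<lambda>i. pdiff i ^^ Poly_Mapping.lookup 0 i :: ('a, 'b) mpol \<Rightarrow> _"
  interpret comp_fun_commute ?F
    by (rule pdiff_comp_fun_commute)
  have "finite I \<Longrightarrow> Finite_Set.fold ?F f I = f" for I
  proof (induction rule: finite_induct)
    case (insert x F)
    show ?case
      unfolding fold_insert[OF insert.hyps] insert.IH by simp
  qed simp
  from this[OF finite] show ?thesis
    unfolding mdiff_def .
qed

lemma mdiff_single: "mdiff (Poly_Mapping.single i n) f = (pdiff i ^^ n) f"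
proof -
  let ?F = "\<lambda>j. pdiff j ^^ Poly_Mapping.lookup (Poly_Mapping.single i n) j :: ('a, 'b) mpol \<Rightarrow> _"
  interpret comp_fun_commute ?F
    by (rule pdiff_comp_fun_commute)
  have *: "finite I \<Longrightarrow> i \<notin> I \<Longrightarrow> Finite_Set.fold ?F f I = f" for I
  proof (induction rule: finite_induct)
    case (insert x F)
    have "i \<noteq> x" "i \<notin> F"
      using insert.prems by blast+
    then have Fx: "?F x = id"
      by (simp add: lookup_single fun_eq_iff)
    show ?case
      unfolding fold_insert[OF insert.hyps] insert.IH[OF \<open>i \<notin> F\<close>] Fx by simp
  qed simp
  have "Finite_Set.fold ?F f (insert i (UNIV - {i})) = ?F i (Finite_Set.fold ?F f (UNIV - {i}))"
    by (rule fold_insert) auto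
  also have "Finite_Set.fold ?F f (UNIV - {i}) = f"
    by (rule *) auto
  finally show ?thesis
    by (simp only: mdiff_def insert_Diff_single insert_UNIV lookup_single_eq)
qed

lemma Const_zero [simp]: "Const 0 = 0"
  and Const_one [simp]: "Const 1 = 1"
  and Const_add: "Const (c + d) = Const c + Const d"
  by (simp_all add: Const_def single_add)

lemma Tn_superset:
  assumes "finite A" "Poly_Mapping.keys p \<subseteq> A"
  shows "Tn p f = (\<Sum>a\<in>A. Const (Poly_Mapping.lookup p a) * mdiff a f)"
  unfolding Tn_def by (rule sum.mono_neutral_left[OF assms]) (auto simp: in_keys_iff)

lemma Tn_single: "Tn (Poly_Mapping.single a c) f = Const c * mdiff a f"
  by (subst Tn_superset[of "{a}"]) auto

lemma Tn_Const: "Tn (Const c) f = Const c * f"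
  by (simp add: Const_def Tn_single mdiff_zero)

lemma Tn_Var: "Tn (Var i) f = pdiff i f"
  by (simp add: Var_def monomial_def Tn_single mdiff_single)

lemma Tn_add_left: "Tn (p + q) f = Tn p f + Tn q f"
proof -
  let ?A = "Poly_Mapping.keys p \<union> Poly_Mapping.keys q"
  have "Tn (p + q) f = (\<Sum>a\<in>?A. Const (Poly_Mapping.lookup (p + q) a) * mdiff a f)"
    by (rule Tn_superset) (auto simp: keys_add)
  also have "\<dots> = (\<Sum>a\<in>?A. Const (Poly_Mapping.lookup p a) * mdiff a f) +
      (\<Sum>a\<in>?A. Const (Poly_Mapping.lookup q a) * mdiff a f)"
    by (simp add: lookup_add Const_add distrib_right sum.distrib)
  also have "\<dots> = Tn p f + Tn q f"
    by (subst (1 2) Tn_superset[of ?A]) auto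
  finally show ?thesis .
qed

lemma Tn_add_right: "Tn p (f + g) = Tn p f + Tn p g"
  by (simp add: Tn_def mdiff_add distrib_left sum.distrib)

lemma Tn_sum_left: "finite A \<Longrightarrow> Tn (sum g A) f = (\<Sum>x\<in>A. Tn (g x) f)"
  by (induction rule: finite_induct) (simp_all add: Tn_add_left, simp add: Tn_def)

lemma Tn_sum_right: "finite A \<Longrightarrow> Tn p (sum g A) = (\<Sum>x\<in>A. Tn p (g x))"
  by (simp add: Tn_def mdiff_sum sum_distrib_left) (rule sum.swap)

lemma mpol_eq_sum_single:
  "p = (\<Sum>a\<in>Poly_Mapping.keys p. Poly_Mapping.single a (Poly_Mapping.lookup p a))"
  by (rule poly_mapping_eqI)
     (auto simp: lookup_sum lookup_single when_def in_keys_iff)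

lemma Tn_mult: "Tn (p * q) f = Tn p (Tn q f)"
proof -
  let ?P = "Poly_Mapping.keys p" and ?Q = "Poly_Mapping.keys q"
  let ?p = "\<lambda>a. Poly_Mapping.single a (Poly_Mapping.lookup p a)"
  let ?q = "\<lambda>a. Poly_Mapping.single a (Poly_Mapping.lookup q a)"
  have single: "Tn (?p a * ?q b) f = Tn (?p a) (Tn (?q b) f)" for a b
  proof -
    have "Tn (?p a * ?q b) f =
        Const (Poly_Mapping.lookup p a * Poly_Mapping.lookup q b) * mdiff (a + b) f"
      by (simp add: mult_single Tn_single)
    also have "Const (Poly_Mapping.lookup p a * Poly_Mapping.lookup q b) =
        (Const (Poly_Mapping.lookup p a) * Const (Poly_Mapping.lookup q b) :: ('a, 'b) mpol)"
      by (simp add: Const_def mult_single)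
    finally show ?thesis
      by (simp add: Tn_single mdiff_Const_times mdiff_mdiff mult.assoc)
  qed
  have "p * q = (\<Sum>a\<in>?P. \<Sum>b\<in>?Q. ?p a * ?q b)"
    by (subst mpol_eq_sum_single[of p], subst mpol_eq_sum_single[of q]) (rule sum_product)
  then have "Tn (p * q) f = (\<Sum>a\<in>?P. \<Sum>b\<in>?Q. Tn (?p a) (Tn (?q b) f))"
    by (simp add: Tn_sum_left single)
  also have "\<dots> = (\<Sum>a\<in>?P. Tn (?p a) (\<Sum>b\<in>?Q. Tn (?q b) f))"
    by (simp add: Tn_sum_right)
  also have "(\<Sum>b\<in>?Q. Tn (?q b) f) = Tn q f"
    using Tn_sum_left[of ?Q ?q f] by (simp flip: mpol_eq_sum_single)
  also have "(\<Sum>a\<in>?P. Tn (?p a) (Tn q f)) = Tn p (Tn q f)"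
    using Tn_sum_left[of ?P ?p "Tn q f"] by (simp flip: mpol_eq_sum_single)
  finally show ?thesis .
qed

lemma module_Tn: "Modules.module (Tn :: ('n::finite, 'k::comm_ring_1) mpol \<Rightarrow> _)"
proof
  show "Tn 1 x = x" for x :: "('n, 'k) mpol"
    using Tn_Const[of 1 x] by simp
qed (simp_all add: Tn_add_left Tn_add_right Tn_mult)

lemma vector_space_kscale:
  fixes s :: "('n, 'k::field) mpol \<Rightarrow> 'm::ab_group_add \<Rightarrow> 'm"
  assumes "Modules.module s"
  shows "vector_space (kscale s)"
proof -
  interpret Modules.module s by fact
  have "Const (a * b) = (Const a * Const b :: ('n, 'k) mpol)" for a b
    by (simp add: Const_def mult_single)
  then show ?thesis
    by unfold_locales
       (simp_all add: kscale_def Const_add scale_right_distrib scale_left_distrib)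
qed

lemma mod_End_UNIV:
  assumes "Modules.module s"
  shows "f \<in> mod_End s UNIV \<longleftrightarrow> module_hom s s f"
  using assms by (auto simp: mod_End_def module_hom_def module_hom_axioms_def)

lemma group_mod_AutGroup:
  assumes "Modules.module s" "Modules.module.subspace s W"
  shows "group (mod_AutGroup s W)"
proof -
  interpret Modules.module s by fact
  interpret B: group "BijGroup W" by (rule group_BijGroup)
  have W: "x + y \<in> W" "s r x \<in> W" if "x \<in> W" "y \<in> W" for x y r
    using assms(2) that by (auto simp: subspace_def)
  have "subgroup (mod_End s W \<inter> Bij W) (BijGroup W)"
  proof (rule B.subgroupI)
    have "(\<lambda>x\<in>W. x) \<in> mod_End s W \<inter> Bij W"
      using W by (auto simp: mod_End_def id_Bij)
    then show "mod_End s W \<inter> Bij W \<noteq> {}" by blast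
  next
    fix f assume f: "f \<in> mod_End s W \<inter> Bij W"
    have inv: "inv\<^bsub>BijGroup W\<^esub> f = restrict (inv_into W f) W"
      using f by (intro inv_BijGroup) auto
    have "inv\<^bsub>BijGroup W\<^esub> f \<in> Bij W"
      using f unfolding inv by (intro restrict_inv_into_Bij) auto
    moreover have "restrict (inv_into W f) W \<in> mod_End s W"
    proof -
      have bij: "bij_betw f W W" using f by (auto simp: Bij_def)
      have g: "inv_into W f x \<in> W" "f (inv_into W f x) = x" if "x \<in> W" for x
        using bij that by (auto simp: bij_betw_def inv_into_into f_inv_into_f)
      have eq: "inv_into W f (f x) = x" if "x \<in> W" for x
        using bij that by (auto simp: bij_betw_def)
      have add: "inv_into W f (x + y) = inv_into W f x + inv_into W f y" if "x \<in> W" "y \<in> W" for x y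
      proof -
        have "f (inv_into W f x + inv_into W f y) = x + y"
          using f that g by (auto simp: mod_End_def)
        then show ?thesis using eq[of "inv_into W f x + inv_into W f y"] g that W by auto
      qed
      have sc: "inv_into W f (s r x) = s r (inv_into W f x)" if "x \<in> W" for x r
      proof -
        have "f (s r (inv_into W f x)) = s r x"
          using f that g by (auto simp: mod_End_def)
        then show ?thesis using eq[of "s r (inv_into W f x)"] g that W by auto
      qed
      show ?thesis
        using g W by (auto simp: mod_End_def add sc)
    qed
    ultimately show "inv\<^bsub>BijGroup W\<^esub> f \<in> mod_End s W \<inter> Bij W"
      by (simp add: inv)
  next
    fix f g assume fg: "f \<in> mod_End s W \<inter> Bij W" "g \<in> mod_End s W \<inter> Bij W"
    have "compose W f g \<in> mod_End s W"
      using fg W by (auto simp: mod_End_def compose_def PiE_iff Pi_iff)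
    then show "f \<otimes>\<^bsub>BijGroup W\<^esub> g \<in> mod_End s W \<inter> Bij W"
      using fg by (auto simp: BijGroup_def compose_Bij)
  qed (auto simp: BijGroup_def)
  then show ?thesis
    unfolding mod_AutGroup_def by (rule B.subgroup_imp_group)
qed

lemma group_K_grp: "group (K_grp m :: ('k::field \<times> (nat \<Rightarrow> 'k)) monoid)"
proof -
  interpret ring "ring_of_type_algebra :: 'k ring"
    by (rule ring_from_type_algebra)
  have "group (add_grp :: 'k monoid)"
    unfolding add_grp_def by (rule a_group)
  then show ?thesis
    unfolding K_grp_def mult_grp_def by (intro DirProd_group units_group product_group)
qed

end

theory Submission
  imports Defs
begin

text \<open>
  All three statements come from one construction: if a module over \<open>\<K>[X]\<close> has a
  multiplicative family of polynomials \<open>Y\<^sup>a\<close>, indexed by exponents, such that only finitely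
  many of them act nontrivially on any given vector, then every power series
  \<open>\<Sum> f\<^sub>a Y\<^sup>a\<close> acts on the module, and the module becomes a module over \<open>\<K>[[X]]\<close>
  (locale \<open>locally_nilpotent_module\<close>). Power series act by endomorphisms, so what has to be
  shown in each case is that they give all endomorphisms.

  On \<open>T\<^sub>n\<close> the monomials themselves act locally nilpotently, by differentiation. A polynomial is
  determined by the values at \<open>0\<close> of its partial derivatives, and an endomorphism commutes
  with differentiation; hence it is determined by the linear functional
  \<open>v \<mapsto> \<phi>(v)(0)\<close>. Every linear functional on \<open>T\<^sub>n\<close> is
  \<open>v \<mapsto> (\<Sum> f\<^sub>a \<partial>\<^sup>a v)(0)\<close> for exactly one power series. This gives
  \<open>End(T\<^sub>n) \<cong> \<K>[[X]]\<close>. The same argument applies to the submodule spanned by the monomials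
  with exponents in a set \<open>B\<close> closed under divisors: its endomorphisms are the power series
  modulo those that vanish on \<open>B\<close> (\<open>endomorphism_eq_ev\<close>, \<open>ev_faithful\<close>).

  The multiplicative group of \<open>\<K>[[X]]\<close> is made additive by the logarithmic derivative: with the
  Euler derivation \<open>D x\<^sup>a = |a| x\<^sup>a\<close>, the map \<open>f \<mapsto> (f 0, D f / f)\<close> is an isomorphism from
  the units onto the product of \<open>\<K>\<^sup>*\<close> and the additive group of the series without constant
  term. It is a homomorphism by the Leibniz rule. Its inverse solves \<open>D f = t f\<close> for \<open>f\<close>,
  coefficient by coefficient, where the division by \<open>|a|\<close> uses characteristic zero. Since
  \<open>D\<close> is graded, this is compatible with restricting exponents to a finite \<open>B\<close>; the additive
  part then has one coordinate for each nonzero element of \<open>B\<close>, which proves the second part.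

  In a finite dimensional module with one-dimensional socle, the socle is a line on which each
  variable \<open>x\<^sub>i\<close> acts   as a scalar \<open>\<mu>\<^sub>i\<close>, and this
  line lies in every nonzero submodule. Therefore \<open>x\<^sub>i - \<mu>\<^sub>i\<close> is
  nilpotent, and power series act through the monomials in the \<open>x\<^sub>i -
  \<mu>\<^sub>i\<close>. Choose a linear   functional \<open>\<psi>\<close> that is nonzero on
  the socle. The functionals \<open>v \<mapsto> \<psi>(p v)\<close> with \<open>p\<close> in
  \<open>\<K>[X]\<close> separate vectors, so they are all functionals; comparing them with
  \<open>\<psi> \<circ> \<phi>\<close> shows   that every endomorphism \<open>\<phi>\<close> is
  multiplication by a polynomial   (\<open>endomorphism_eq_polynomial\<close>). Hence the
  homomorphism from \<open>\<K>\<^sup>* \<times> (\<K>\<^sup>+)\<^sup>m\<close>   to the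
  automorphism group is surjective, and its kernel gives the quotient.
\<close>

section \<open>Exponents\<close>

definition deg :: "'n::finite mon \<Rightarrow> nat" where
  "deg a = (\<Sum>i\<in>UNIV. Poly_Mapping.lookup a i)"

lemma deg_add: "deg (a + b) = deg a + deg b"
  by (simp add: deg_def lookup_add sum.distrib)

lemma deg_eq_0_iff [simp]: "deg a = 0 \<longleftrightarrow> a = 0"
  by (auto simp: deg_def poly_mapping_eq_iff fun_eq_iff)

lemma deg_zero [simp]: "deg 0 = 0"
  by simp

lemma deg_less_add: "b \<noteq> 0 \<Longrightarrow> deg a < deg (a + b)"
  using deg_eq_0_iff[of b] by (simp add: deg_add del: deg_eq_0_iff)

lemma deg_less_add_left: "a \<noteq> 0 \<Longrightarrow> deg b < deg (a + b)"
  by (simp add: deg_add flip: neq0_conv)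

lemma mon_add_eq_0_iff: "a + b = 0 \<longleftrightarrow> a = 0 \<and> b = 0" for a b :: "'n::finite mon"
  using deg_eq_0_iff[of "a + b"] by (simp only: deg_add add_is_0 deg_eq_0_iff)

text \<open>
  Both equations between power series below are solved coefficient by coefficient, each
  coefficient depending on those of smaller total degree.
\<close>

lemma mon_recursion:
  fixes H :: "('n::finite mon \<Rightarrow> 'a) \<Rightarrow> 'n mon \<Rightarrow> 'a"
  assumes "\<And>f g c. (\<And>b. deg b < deg c \<Longrightarrow> f b = g b) \<Longrightarrow> H f c = H g c"
  shows "\<exists>f. \<forall>c. f c = H f c"
proof -
  let ?R = "inv_image less_than (deg :: 'n mon \<Rightarrow> nat)"
  have "adm_wf ?R H"
    unfolding adm_wf_def
  proof (intro allI impI)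
    fix f g :: "'n mon \<Rightarrow> 'a" and c
    assume "\<forall>b. (b, c) \<in> ?R \<longrightarrow> f b = g b"
    then show "H f c = H g c" by (intro assms) simp
  qed
  then have "wfrec ?R H = H (wfrec ?R H)"
    by (rule wfrec_fixpoint[OF wf_inv_image[OF wf_less_than]])
  then show ?thesis
    by (intro exI[of _ "wfrec ?R H"] allI) (rule fun_cong)
qed

lemma mon_induct [case_names zero add_var]:
  fixes a :: "'n::finite mon"
  assumes "P 0" and step: "\<And>a i. P a \<Longrightarrow> P (a + Poly_Mapping.single i 1)"
  shows "P a"
proof (induction a rule: measure_induct_rule[of deg])
  case (less a)
  show ?case
  proof (cases "a = 0")
    case False
    then obtain i where i: "Poly_Mapping.lookup a i \<noteq> 0"
      by (auto simp: poly_mapping_eq_iff fun_eq_iff)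
    let ?b = "a - Poly_Mapping.single i 1"
    have a: "a = ?b + Poly_Mapping.single i 1"
      using i by (intro poly_mapping_eqI) (auto simp: lookup_add lookup_minus lookup_single when_def)
    have "deg ?b < deg (?b + Poly_Mapping.single i 1)"
      by (rule deg_less_add) (simp add: poly_mapping_eq_iff fun_eq_iff lookup_single when_def exI[of _ i])
    then have "P ?b" using less a by simp
    then show ?thesis by (subst a) (rule step)
  qed (use assms in simp)
qed

text \<open>
  The box consists of divisors of the single monomial whose exponents are all equal to \<open>N\<close>.
\<close>

lemma finite_mon_box: "finite {a :: 'n::finite mon. \<forall>i. Poly_Mapping.lookup a i < N}"
proof -
  define c :: "'n mon" where "c = (\<Sum>i\<in>UNIV. Poly_Mapping.single i N)"
  have c: "Poly_Mapping.lookup c i = N" for i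
    by (simp add: c_def lookup_sum lookup_single when_def)
  have "{a :: 'n mon. \<forall>i. Poly_Mapping.lookup a i < N} \<subseteq> fst ` {(a, b). a + b = c}"
  proof
    fix a :: "'n mon" assume a: "a \<in> {a. \<forall>i. Poly_Mapping.lookup a i < N}"
    have "a + (c - a) = c"
      using a by (intro poly_mapping_eqI) (simp add: lookup_add lookup_minus c less_imp_le)
    then show "a \<in> fst ` {(a, b). a + b = c}" by force
  qed
  then show ?thesis by (rule finite_subset) (simp add: finite_mon_antidiagonal)
qed


section \<open>Power series and logarithmic derivatives\<close>

type_synonym ('n, 'k) mps = "'n mon \<Rightarrow> 'k"

abbreviation cauchy :: "('n::finite, 'k::comm_ring_1) mps \<Rightarrow> ('n, 'k) mps \<Rightarrow> ('n, 'k) mps"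
    (infixl \<open>\<star>\<close> 70) where
  "f \<star> g \<equiv> f \<otimes>\<^bsub>mps_algebra\<^esub> g"

abbreviation mps_one :: "('n::finite, 'k::comm_ring_1) mps" where
  "mps_one \<equiv> \<one>\<^bsub>mps_algebra\<^esub>"

lemma cauchy_apply: "(f \<star> g) c = (\<Sum>(a, b)\<in>{(a, b). a + b = c}. f a * g b)"
  by (simp add: mps_algebra_def)

lemma cring_mps: "cring (mps_algebra :: ('k::comm_ring_1, 'n::finite mon \<Rightarrow> 'k) module)"
  using algebra_mps_algebra by (rule algebra.axioms)

lemma carrier_mps [simp]: "carrier mps_algebra = UNIV"
  by (simp add: mps_algebra_def)

lemma mps_one_apply: "mps_one c = (if c = 0 then 1 else 0)"
  by (simp add: mps_algebra_def)

lemma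
  fixes f g h :: "('n::finite, 'k::comm_ring_1) mps"
  shows cauchy_assoc: "f \<star> g \<star> h = f \<star> (g \<star> h)"
    and cauchy_commute: "f \<star> g = g \<star> f"
    and cauchy_left_commute: "f \<star> (g \<star> h) = g \<star> (f \<star> h)"
    and cauchy_add_left: "(\<lambda>c. f c + g c) \<star> h = (\<lambda>c. (f \<star> h) c + (g \<star> h) c)"
proof -
  interpret cring "mps_algebra :: ('k, 'n mon \<Rightarrow> 'k) module" by (rule cring_mps)
  show "f \<star> g \<star> h = f \<star> (g \<star> h)" "f \<star> g = g \<star> f" "f \<star> (g \<star> h) = g \<star> (f \<star> h)"
    by (simp_all add: m_ac)
  show "(\<lambda>c. f c + g c) \<star> h = (\<lambda>c. (f \<star> h) c + (g \<star> h) c)"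
    using l_distr[of f g h] by (simp add: mps_algebra_def)
qed

lemma cauchy_zero:
  fixes f g :: "('n::finite, 'k::comm_ring_1) mps"
  shows "(f \<star> g) 0 = f 0 * g 0"
proof -
  have "{(a, b). a + b = (0 :: 'n mon)} = {(0, 0)}"
    by (auto simp: mon_add_eq_0_iff)
  then show ?thesis by (simp add: cauchy_apply)
qed

lemma cauchy_split_right:
  "(f \<star> g) c = f c * g 0 + (\<Sum>(a, b)\<in>{(a, b). a + b = c \<and> b \<noteq> 0}. f a * g b)"
proof -
  have eq: "{(a, b). a + b = c} = insert (c, 0) {(a, b). a + b = c \<and> b \<noteq> 0}"
    by auto
  have "finite {(a, b). a + b = c \<and> b \<noteq> 0}"
    by (rule finite_subset[OF _ finite_mon_antidiagonal[of c]]) auto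
  then show ?thesis
    unfolding cauchy_apply eq by (subst sum.insert) auto
qed

lemma cauchy_split_left:
  "(f \<star> g) c = f 0 * g c + (\<Sum>(a, b)\<in>{(a, b). a + b = c \<and> a \<noteq> 0}. f a * g b)"
proof -
  have eq: "{(a, b). a + b = c} = insert (0, c) {(a, b). a + b = c \<and> a \<noteq> 0}"
    by auto
  have "finite {(a, b). a + b = c \<and> a \<noteq> 0}"
    by (rule finite_subset[OF _ finite_mon_antidiagonal[of c]]) auto
  then show ?thesis
    unfolding cauchy_apply eq by (subst sum.insert) auto
qed

text \<open>
  The equation \<open>D f = t f\<close> for the Euler derivation \<open>D x\<^sup>a = |a| x\<^sup>a\<close>. It is stated without
  dividing by \<open>f\<close>, so that it can be read as an equation for either of the two series.
\<close>

definition has_log_deriv :: "('n::finite, 'k::comm_ring_1) mps \<Rightarrow> ('n, 'k) mps \<Rightarrow> bool" where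
  "has_log_deriv f t \<longleftrightarrow> (\<forall>c. of_nat (deg c) * f c = (t \<star> f) c)"

text \<open>
  The total degree is additive, so multiplying the coefficient at \<open>x\<^sup>a\<close> by \<open>|a|\<close> is a
  derivation.
\<close>

lemma euler_leibniz:
  "of_nat (deg c) * (f \<star> g) c =
     ((\<lambda>c. of_nat (deg c) * f c) \<star> g) c + (f \<star> (\<lambda>c. of_nat (deg c) * g c)) c"
proof -
  have "of_nat (deg c) * (f \<star> g) c =
      (\<Sum>(a, b)\<in>{(a, b). a + b = c}. of_nat (deg (a + b)) * (f a * g b))"
    by (auto simp: cauchy_apply sum_distrib_left intro!: sum.cong)
  also have "\<dots> = (\<Sum>(a, b)\<in>{(a, b). a + b = c}.
      of_nat (deg a) * f a * g b + f a * (of_nat (deg b) * g b))"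
    by (intro sum.cong refl) (auto simp only: deg_add of_nat_add algebra_simps split: prod.splits)
  finally show ?thesis
    by (simp only: cauchy_apply sum.distrib case_prod_unfold)
qed

lemma has_log_deriv_one: "has_log_deriv mps_one (\<lambda>_. 0)"
proof -
  have "((\<lambda>_. 0) \<star> mps_one) c = 0" for c :: "'a mon"
    by (simp add: cauchy_apply)
  moreover have "of_nat (deg c) * mps_one c = 0" for c :: "'a mon"
    by (simp add: mps_one_apply)
  ultimately show ?thesis unfolding has_log_deriv_def by metis
qed

text \<open>
  This is what turns multiplication of units into addition:
  \<open>D (f g) = D f g + f D g = (t + u) f g\<close>.
\<close>

lemma has_log_deriv_mult:
  assumes "has_log_deriv f t" "has_log_deriv g u"
  shows "has_log_deriv (f \<star> g) (\<lambda>c. t c + u c)"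
proof -
  have "(\<lambda>c. of_nat (deg c) * f c) = t \<star> f" "(\<lambda>c. of_nat (deg c) * g c) = u \<star> g"
    using assms by (blast intro: ext dest: has_log_deriv_def[THEN iffD1, rule_format])+
  then show ?thesis
    unfolding has_log_deriv_def euler_leibniz cauchy_add_left
    by (simp only: cauchy_assoc cauchy_left_commute) simp
qed

lemma log_deriv_constant_term:
  fixes f t :: "('n::finite, 'k::field) mps"
  assumes "has_log_deriv f t" "f 0 \<noteq> 0"
  shows "t 0 = 0"
proof -
  have "t 0 * f 0 = 0"
    using assms(1)[unfolded has_log_deriv_def, rule_format, of 0] by (simp add: cauchy_zero)
  then show ?thesis using assms(2) by simp
qed

text \<open>
  The coefficient of \<open>t f\<close> at \<open>c\<close> is \<open>t\<^sub>c f\<^sub>0\<close> plus terms that involve only coefficients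
  of \<open>t\<close> in smaller degree, so \<open>D f = t f\<close> can be solved for \<open>t\<close> if \<open>f\<^sub>0\<close> is invertible.
\<close>

lemma exists_log_deriv:
  fixes f :: "('n::finite, 'k::field) mps"
  assumes "f 0 \<noteq> 0"
  obtains t where "has_log_deriv f t"
proof -
  let ?H = "\<lambda>t c. (of_nat (deg c) * f c - (\<Sum>(a, b)\<in>{(a, b). a + b = c \<and> b \<noteq> 0}. t a * f b)) / f 0"
  have "\<exists>t. \<forall>c. t c = ?H t c"
  proof (rule mon_recursion)
    fix t u :: "('n, 'k) mps" and c :: "'n mon"
    assume IH: "\<And>b. deg b < deg c \<Longrightarrow> t b = u b"
    have "(\<Sum>(a, b)\<in>{(a, b). a + b = c \<and> b \<noteq> 0}. t a * f b) =
        (\<Sum>(a, b)\<in>{(a, b). a + b = c \<and> b \<noteq> 0}. u a * f b)"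
    proof (intro sum.cong refl, clarify)
      fix a b :: "'n mon" assume "b \<noteq> 0" "c = a + b"
      then have "t a = u a" by (simp only: IH deg_less_add not_False_eq_True)
      then show "t a * f b = u a * f b" by (simp only:)
    qed
    then show "?H t c = ?H u c" by simp
  qed
  then obtain t where t: "\<And>c. t c = ?H t c" by blast
  have "of_nat (deg c) * f c = (t \<star> f) c" for c
    using assms by (simp add: cauchy_split_right t[of c])
  then show ?thesis
    by (intro that[of t]) (simp add: has_log_deriv_def)
qed

text \<open>
  Conversely \<open>D f = t f\<close> can be solved for \<open>f\<close> with prescribed constant term: if \<open>t\<^sub>0 = 0\<close>,
  the coefficient of \<open>t f\<close> at \<open>c\<close> involves only coefficients of \<open>f\<close> in degree smaller
  than \<open>|c|\<close>. The solution is \<open>k exp(\<integral>t)\<close> with \<open>\<integral>\<close> the inverse of \<open>D\<close>.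
\<close>

lemma exists_with_log_deriv:
  fixes t :: "('n::finite, 'k::field_char_0) mps"
  assumes "t 0 = 0"
  obtains f where "f 0 = k" "has_log_deriv f t"
proof -
  let ?H = "\<lambda>f c. if c = 0 then k
      else (\<Sum>(a, b)\<in>{(a, b). a + b = c \<and> a \<noteq> 0}. t a * f b) / of_nat (deg c)"
  have "\<exists>f. \<forall>c. f c = ?H f c"
  proof (rule mon_recursion)
    fix f g :: "('n, 'k) mps" and c :: "'n mon"
    assume IH: "\<And>b. deg b < deg c \<Longrightarrow> f b = g b"
    have "(\<Sum>(a, b)\<in>{(a, b). a + b = c \<and> a \<noteq> 0}. t a * f b) =
        (\<Sum>(a, b)\<in>{(a, b). a + b = c \<and> a \<noteq> 0}. t a * g b)"
    proof (intro sum.cong refl, clarify)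
      fix a b :: "'n mon" assume "a \<noteq> 0" "c = a + b"
      then have "f b = g b" by (simp only: IH deg_less_add_left not_False_eq_True)
      then show "t a * f b = t a * g b" by (simp only:)
    qed
    then show "?H f c = ?H g c" by (simp only:)
  qed
  then obtain f where f: "\<forall>c. f c = ?H f c" by (rule exE)
  have "of_nat (deg c) * f c = (t \<star> f) c" for c
  proof (cases "c = 0")
    case True
    have "(t \<star> f) 0 = 0" unfolding cauchy_zero assms by (rule mult_zero_left)
    then show ?thesis unfolding True by simp
  next
    case False
    then have nz: "(of_nat (deg c) :: 'k) \<noteq> 0" by simp
    let ?S = "\<Sum>(a, b)\<in>{(a, b). a + b = c \<and> a \<noteq> 0}. t a * f b"
    have "f c = ?S / of_nat (deg c)"
      by (rule trans[OF f[rule_format, of c]]) (rule if_not_P[OF False])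
    then have "of_nat (deg c) * f c = ?S"
      using nz by (simp add: eq_divide_eq mult.commute)
    also have "\<dots> = (t \<star> f) c"
      unfolding cauchy_split_left assms by simp
    finally show ?thesis .
  qed
  then have "has_log_deriv f t"
    unfolding has_log_deriv_def by (rule allI)
  moreover have "f 0 = k"
    by (rule trans[OF f[rule_format, of 0]]) (rule if_P[OF refl])
  ultimately show ?thesis
    by (intro that)
qed

lemma log_deriv_determines:
  fixes f g t :: "('n::finite, 'k::field_char_0) mps"
  assumes "has_log_deriv f t" "has_log_deriv g t" "f 0 = g 0" "t 0 = 0"
  shows "f = g"
proof
  fix c
  show "f c = g c"
  proof (induction c rule: measure_induct_rule[of deg])
    case (less c)
    show ?case
    proof (cases "c = 0")
      case False
      then have nz: "(of_nat (deg c) :: 'k) \<noteq> 0" by simp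
      have "(\<Sum>(a, b)\<in>{(a, b). a + b = c \<and> a \<noteq> 0}. t a * f b) =
          (\<Sum>(a, b)\<in>{(a, b). a + b = c \<and> a \<noteq> 0}. t a * g b)"
      proof (intro sum.cong refl, clarify)
        fix a b :: "'n mon" assume "a \<noteq> 0" "c = a + b"
        then have "f b = g b" by (simp only: less deg_less_add_left not_False_eq_True)
        then show "t a * f b = t a * g b" by (simp only:)
      qed
      then have "of_nat (deg c) * f c = of_nat (deg c) * g c"
        using assms by (simp add: has_log_deriv_def cauchy_split_left)
      with nz show ?thesis by simp
    qed (use assms in simp)
  qed
qed

text \<open>
  The logarithmic derivative of a unit on a set of exponents closed under divisors depends only
  on the unit there. This yields injectivity for truncated series.
\<close>

lemma log_deriv_eq_on:
  fixes f g :: "('n::finite, 'k::field) mps"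
  assumes f: "has_log_deriv f t" and g: "has_log_deriv g u" and nz: "f 0 \<noteq> 0"
    and divisors: "\<And>a b. a + b \<in> B \<Longrightarrow> a \<in> B"
    and eq: "\<And>a. a \<in> B \<Longrightarrow> f a = g a"
  shows "c \<in> B \<Longrightarrow> t c = u c"
proof (induction c rule: measure_induct_rule[of deg])
  case (less c)
  have "0 \<in> B" using divisors[of 0 c] less.prems by simp
  have "(\<Sum>(a, b)\<in>{(a, b). a + b = c \<and> b \<noteq> 0}. t a * f b) =
      (\<Sum>(a, b)\<in>{(a, b). a + b = c \<and> b \<noteq> 0}. u a * g b)"
  proof (intro sum.cong refl, clarify)
    fix a b :: "'n mon" assume ab: "b \<noteq> 0" "c = a + b"
    then have "a \<in> B" "b \<in> B"
      using divisors[of a b] divisors[of b a] less.prems by (simp_all add: add.commute)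
    moreover have "t a = u a"
      using less.IH[of a] ab \<open>a \<in> B\<close> by (simp add: deg_less_add)
    ultimately show "t a * f b = u a * g b" using eq by simp
  qed
  moreover have "(t \<star> f) c = (u \<star> g) c"
    using f g eq[OF less.prems] by (simp add: has_log_deriv_def flip: f[unfolded has_log_deriv_def, rule_format])
  ultimately have "t c * f 0 = u c * g 0"
    by (simp add: cauchy_split_right)
  then show ?case using eq[OF \<open>0 \<in> B\<close>] nz by simp
qed

definition series_of_log_deriv :: "'k::field_char_0 \<Rightarrow> ('n::finite, 'k) mps \<Rightarrow> ('n, 'k) mps" where
  "series_of_log_deriv k t = (THE f. f 0 = k \<and> has_log_deriv f t)"

lemma
  assumes "t 0 = 0"
  shows series_of_log_deriv_0: "series_of_log_deriv k t 0 = k"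
    and has_log_deriv_series: "has_log_deriv (series_of_log_deriv k t) t"
proof -
  have "\<exists>!f. f 0 = k \<and> has_log_deriv f t"
    using exists_with_log_deriv[of t k] log_deriv_determines[of _ t] assms by metis
  from theI'[OF this] show "series_of_log_deriv k t 0 = k"
      "has_log_deriv (series_of_log_deriv k t) t"
    by (simp_all add: series_of_log_deriv_def)
qed

lemma series_of_log_deriv_eqI:
  assumes "has_log_deriv f t" "t 0 = 0"
  shows "series_of_log_deriv (f 0) t = f"
  using assms log_deriv_determines series_of_log_deriv_0 has_log_deriv_series by metis

lemma series_of_log_deriv_mult:
  assumes "t 0 = 0" "u 0 = 0"
  shows "series_of_log_deriv k t \<star> series_of_log_deriv l u =
    series_of_log_deriv (k * l) (\<lambda>c. t c + u c)"
proof -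
  let ?f = "series_of_log_deriv k t" and ?g = "series_of_log_deriv l u"
  have "has_log_deriv (?f \<star> ?g) (\<lambda>c. t c + u c)"
    using assms by (intro has_log_deriv_mult has_log_deriv_series)
  moreover have "(?f \<star> ?g) 0 = k * l"
    using assms by (simp add: cauchy_zero series_of_log_deriv_0)
  ultimately show ?thesis
    using series_of_log_deriv_eqI[of "?f \<star> ?g" "\<lambda>c. t c + u c"] assms by simp
qed

lemma series_of_log_deriv_one: "series_of_log_deriv 1 (\<lambda>_. 0) = mps_one"
  using series_of_log_deriv_eqI[OF has_log_deriv_one] by (simp add: mps_one_apply)

lemma series_of_log_deriv_inverse:
  assumes "t 0 = 0" "k \<noteq> 0"
  shows "series_of_log_deriv k t \<star> series_of_log_deriv (inverse k) (\<lambda>c. - t c) = mps_one"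
  using assms by (simp add: series_of_log_deriv_mult series_of_log_deriv_one)

text \<open>
  Together with \<open>series_of_log_deriv_mult\<close> this says that \<open>(k, t) \<mapsto> series_of_log_deriv k t\<close>
  maps the group of pairs with \<open>k \<noteq> 0\<close> and \<open>t 0 = 0\<close> onto the units of \<open>\<K>[[X]]\<close>.
\<close>

lemma unit_eq_series_of_log_deriv:
  fixes f :: "('n::finite, 'k::field_char_0) mps"
  assumes "f 0 \<noteq> 0"
  obtains t where "t 0 = 0" "f = series_of_log_deriv (f 0) t"
proof -
  obtain t where t: "has_log_deriv f t" using exists_log_deriv[of f] assms by blast
  then have "t 0 = 0" using log_deriv_constant_term assms by blast
  with t show ?thesis using that series_of_log_deriv_eqI[of f t] by simp
qed


section \<open>Power series acting on locally nilpotent modules\<close>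

lemma Const_mult: "Const (a * b) = (Const a * Const b :: ('n, 'k::comm_semiring_1) mpol)"
  by (simp add: Const_def mult_single)

lemma Const_sum: "Const (sum f A) = (\<Sum>x\<in>A. Const (f x) :: ('n, 'k::comm_semiring_1) mpol)"
  by (induction A rule: infinite_finite_induct) (simp_all add: Const_add)

text \<open>
  The family \<open>Y\<close> stands for the monomials in new coordinates: on \<open>T\<^sub>n\<close> these are the variables
  themselves, on a module whose variables have eigenvalues \<open>\<mu>\<^sub>i\<close> they are
  \<open>x\<^sub>i - \<mu>\<^sub>i\<close>. Local finiteness gives a meaning to infinite linear combinations of the
  \<open>Y a\<close> as operators.
\<close>

locale locally_nilpotent_module = Modules.module s
  for s :: "('n::finite, 'k::field) mpol \<Rightarrow> 'm::ab_group_add \<Rightarrow> 'm" +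
  fixes Y :: "'n mon \<Rightarrow> ('n, 'k) mpol"
  assumes Y_0: "Y 0 = 1"
    and Y_add: "Y (a + b) = Y a * Y b"
    and locally_nilpotent: "finite {a. s (Y a) v \<noteq> 0}"
begin

declare scale_scale [simp del]

abbreviation supp :: "'m \<Rightarrow> 'n mon set" where
  "supp v \<equiv> {a. s (Y a) v \<noteq> 0}"

text \<open>
  The value of a power series at the commuting operators \<open>Y\<close>; the sum may be taken over any finite
  set containing the support.
\<close>

definition ev :: "('n, 'k) mps \<Rightarrow> 'm \<Rightarrow> 'm" where
  "ev f v = (\<Sum>a\<in>supp v. s (Const (f a) * Y a) v)"

lemma ev_superset:
  assumes "finite A" "supp v \<subseteq> A"
  shows "ev f v = (\<Sum>a\<in>A. s (Const (f a) * Y a) v)"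
  unfolding ev_def by (rule sum.mono_neutral_left[OF assms]) (auto simp: scale_scale[symmetric])

lemma ev_in_subspace:
  assumes "subspace W" "v \<in> W"
  shows "ev f v \<in> W"
  unfolding ev_def using assms by (intro subspace_sum subspace_scale)

lemma ev_add: "ev f (v + w) = ev f v + ev f w"
proof -
  let ?A = "supp v \<union> supp w"
  have "finite ?A" using locally_nilpotent by blast
  moreover have "supp (v + w) \<subseteq> ?A" by (auto simp: scale_right_distrib)
  ultimately show ?thesis
    by (simp add: ev_superset[of ?A] scale_right_distrib sum.distrib)
qed

lemma ev_scale: "ev f (s p v) = s p (ev f v)"
proof -
  have eq: "s q (s p v) = s p (s q v)" for q
    by (simp only: scale_scale mult.commute)
  have "supp (s p v) \<subseteq> supp v"
    by (rule Collect_mono) (subst eq, auto)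
  then have "ev f (s p v) = (\<Sum>a\<in>supp v. s (Const (f a) * Y a) (s p v))"
    by (rule ev_superset[OF locally_nilpotent])
  then show ?thesis
    unfolding eq by (simp only: ev_def scale_sum_right)
qed

lemma ev_in_mod_End:
  assumes "subspace W"
  shows "restrict (ev f) W \<in> mod_End s W"
  using assms ev_in_subspace by (auto simp: mod_End_def ev_add ev_scale subspace_def)

lemma ev_cong:
  assumes "\<And>a. s (Y a) v \<noteq> 0 \<Longrightarrow> f a = g a"
  shows "ev f v = ev g v"
  unfolding ev_def using assms by (intro sum.cong) auto

lemma ev_series_add: "ev (\<lambda>a. f a + g a) v = ev f v + ev g v"
  by (simp only: ev_def Const_add distrib_right scale_left_distrib sum.distrib)

lemma ev_series_smult: "ev (\<lambda>a. c * f a) v = s (Const c) (ev f v)"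
  by (simp add: ev_def scale_sum_right Const_mult mult.assoc scale_scale)

lemma ev_single:
  assumes "\<And>b. b \<noteq> a \<Longrightarrow> s (Y b) v \<noteq> 0 \<Longrightarrow> f b = 0"
  shows "ev f v = s (Const (f a) * Y a) v"
proof -
  have "ev f v = (\<Sum>b\<in>insert a (supp v). s (Const (f b) * Y b) v)"
    using locally_nilpotent by (intro ev_superset) auto
  also have "\<dots> = (\<Sum>b\<in>{a}. s (Const (f b) * Y b) v)"
    using locally_nilpotent assms by (intro sum.mono_neutral_right) (auto simp: scale_scale[symmetric])
  finally show ?thesis by simp
qed

lemma ev_one: "ev mps_one v = v"
  by (subst ev_single[of 0]) (auto simp: mps_one_apply Y_0)

text \<open>
  Both sides are sums over pairs of exponents. On the right-hand side both exponents range
  over the support of \<open>v\<close>, on the left-hand side only their sum has to lie in it; the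
  additional terms on the right vanish, and a sum in the support has both summands there.
\<close>

lemma ev_mult: "ev (f \<star> g) v = ev f (ev g v)"
proof -
  let ?S = "supp v" and ?T = "\<lambda>c. {(a, b). a + b = (c :: 'n mon)}"
  have down: "a \<in> ?S \<and> b \<in> ?S" if "a + b \<in> ?S" for a b
  proof -
    have "s (Y (a + b)) v = s (Y a) (s (Y b) v)" "s (Y (a + b)) v = s (Y b) (s (Y a) v)"
      by (simp_all add: Y_add scale_scale mult.commute)
    with that show ?thesis by auto
  qed
  let ?t = "\<lambda>(a, b). s (Const (f a * g b) * Y (a + b)) v"
  have "ev f (ev g v) = (\<Sum>b\<in>?S. ev f (s (Const (g b) * Y b) v))"
    unfolding ev_def[of g]
    by (induction rule: finite_induct[OF locally_nilpotent[of v]]) (simp_all add: ev_add, simp add: ev_def)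
  also have "\<dots> = (\<Sum>b\<in>?S. \<Sum>a\<in>?S. ?t (a, b))"
    unfolding ev_scale unfolding ev_def
    by (simp add: scale_sum_right Const_mult Y_add scale_scale ac_simps)
  also have "\<dots> = (\<Sum>a\<in>?S. \<Sum>b\<in>?S. ?t (a, b))"
    by (rule sum.swap)
  also have "\<dots> = (\<Sum>z\<in>?S \<times> ?S. ?t z)"
    by (simp add: sum.cartesian_product)
  also have "\<dots> = (\<Sum>z\<in>(\<lambda>(c, z). z) ` Sigma ?S ?T. ?t z)"
  proof (rule sum.mono_neutral_right)
    show "finite (?S \<times> ?S)" using locally_nilpotent by blast
    show "(\<lambda>(c, z). z) ` Sigma ?S ?T \<subseteq> ?S \<times> ?S"
    proof (rule subsetI)
      fix z assume "z \<in> (\<lambda>(c, z). z) ` Sigma ?S ?T"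
      then obtain a b where "z = (a, b)" "a + b \<in> ?S" by auto
      then show "z \<in> ?S \<times> ?S" using down[of a b] by blast
    qed
    show "\<forall>z\<in>?S \<times> ?S - (\<lambda>(c, z). z) ` Sigma ?S ?T. ?t z = 0"
    proof
      fix z assume z: "z \<in> ?S \<times> ?S - (\<lambda>(c, z). z) ` Sigma ?S ?T"
      obtain a b where ab: "z = (a, b)" by (cases z)
      have "(a + b, z) \<notin> Sigma ?S ?T" using z by force
      then have "s (Y (a + b)) v = 0" using ab by simp
      then show "?t z = 0" using ab by (simp add: scale_scale[symmetric])
    qed
  qed
  also have "\<dots> = (\<Sum>(c, z)\<in>Sigma ?S ?T. ?t z)"
    by (subst sum.reindex) (auto simp: inj_on_def case_prod_unfold)
  also have "\<dots> = (\<Sum>c\<in>?S. \<Sum>z\<in>?T c. ?t z)"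
    by (rule sum.Sigma[symmetric]) (auto simp: locally_nilpotent finite_mon_antidiagonal)
  also have "\<dots> = ev (f \<star> g) v"
    unfolding ev_def
  proof (rule sum.cong[OF refl])
    fix c
    have "(\<Sum>z\<in>?T c. ?t z) = (\<Sum>(a, b)\<in>?T c. s (Const (f a * g b) * Y c) v)"
      by (rule sum.cong) auto
    then show "(\<Sum>z\<in>?T c. ?t z) = s (Const ((f \<star> g) c) * Y c) v"
      by (simp add: cauchy_apply Const_sum sum_distrib_right scale_sum_left case_prod_unfold)
  qed
  finally show ?thesis ..
qed

lemma ev_bij:
  assumes "subspace W" "f \<star> g = mps_one"
  shows "restrict (ev f) W \<in> carrier (mod_AutGroup s W)"
proof -
  have gf: "g \<star> f = mps_one" using assms(2) by (simp only: cauchy_commute)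
  have "bij_betw (ev f) W W"
    by (rule bij_betw_byWitness[where f' = "ev g"])
      (use assms ev_in_subspace in \<open>auto simp: ev_one gf simp flip: ev_mult\<close>)
  then show ?thesis
    using ev_in_mod_End[OF assms(1), of f] by (simp add: mod_AutGroup_def Bij_def cong: bij_betw_cong)
qed

lemma ev_compose:
  assumes "subspace W"
  shows "compose W (restrict (ev f) W) (restrict (ev g) W) = restrict (ev (f \<star> g)) W"
  using ev_in_subspace[OF assms] by (auto simp: compose_def fun_eq_iff ev_mult)

end


section \<open>Automorphisms given by power series\<close>

lemma mod_AutGroup_mult:
  assumes "f \<in> carrier (mod_AutGroup s W)" "g \<in> carrier (mod_AutGroup s W)"
  shows "f \<otimes>\<^bsub>mod_AutGroup s W\<^esub> g = compose W f g"
  using assms by (simp add: mod_AutGroup_def BijGroup_def)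

lemma carrier_K_grp: "carrier (K_grp m) = (UNIV - {0 :: 'k::field}) \<times> ({..<m} \<rightarrow>\<^sub>E UNIV)"
proof -
  have "carrier (mult_grp :: 'k monoid) = UNIV - {0}"
    by (auto simp: mult_grp_def units_of_def Units_def ring_of_type_algebra_def)
      (metis left_inverse right_inverse)
  then show ?thesis
    by (simp add: K_grp_def add_grp_def DirProd_def product_group_def ring_of_type_algebra_def)
qed

lemma mult_K_grp:
  "(k, x) \<otimes>\<^bsub>K_grp m\<^esub> (l, y) = (k * l, \<lambda>i\<in>{..<m}. x i + y i)"
  by (simp add: K_grp_def mult_grp_def add_grp_def DirProd_def product_group_def ring_of_type_algebra_def units_of_def)

text \<open>
  On the submodule \<open>W\<close> only the coefficients with exponents in \<open>B\<close> matter. The map \<open>idx\<close>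
  numbers the nonzero exponents in \<open>B\<close>; the coefficient of a logarithmic derivative at such an
  exponent becomes the coordinate of \<open>(\<K>\<^sup>+)\<^sup>m\<close> with that number.
\<close>

locale finite_support_submodule = locally_nilpotent_module s Y
  for s :: "('n::finite, 'k::field_char_0) mpol \<Rightarrow> 'm::ab_group_add \<Rightarrow> 'm" and Y +
  fixes W :: "'m set" and B :: "'n mon set" and idx :: "'n mon \<Rightarrow> nat"
  assumes subspace_W: "subspace W"
    and zero_in_B: "0 \<in> B"
    and vanishing: "a \<notin> B \<Longrightarrow> v \<in> W \<Longrightarrow> s (Y a) v = 0"
    and bij_idx: "bij_betw idx (B - {0}) {..<card B - 1}"
begin

definition series_of_tuple :: "(nat \<Rightarrow> 'k) \<Rightarrow> ('n, 'k) mps" where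
  "series_of_tuple x a = (if a \<in> B - {0} then x (idx a) else 0)"

text \<open>
  The tuple is read as a logarithmic derivative, not as a list of coefficients of the series:
  this is what makes addition of tuples correspond to composition of automorphisms.
\<close>

definition K_grp_action :: "'k \<times> (nat \<Rightarrow> 'k) \<Rightarrow> 'm \<Rightarrow> 'm" where
  "K_grp_action = (\<lambda>(k, x). restrict (ev (series_of_log_deriv k (series_of_tuple x))) W)"

lemma series_of_tuple_0 [simp]: "series_of_tuple x 0 = 0"
  by (simp add: series_of_tuple_def)

lemma series_of_tuple_add:
  "series_of_tuple (\<lambda>i\<in>{..<card B - 1}. x i + y i) = (\<lambda>c. series_of_tuple x c + series_of_tuple y c)"
  using bij_betwE[OF bij_idx] by (auto simp: series_of_tuple_def fun_eq_iff)

lemma K_grp_action_hom: "K_grp_action \<in> hom (K_grp (card B - 1)) (mod_AutGroup s W)"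
proof (rule homI)
  show car: "K_grp_action z \<in> carrier (mod_AutGroup s W)"
    if "z \<in> carrier (K_grp (card B - 1) :: ('k \<times> (nat \<Rightarrow> 'k)) monoid)" for z
    using that ev_bij[OF subspace_W series_of_log_deriv_inverse]
    by (auto simp: K_grp_action_def carrier_K_grp)
  fix z w :: "'k \<times> (nat \<Rightarrow> 'k)"
  assume "z \<in> carrier (K_grp (card B - 1))" "w \<in> carrier (K_grp (card B - 1))"
  note zw = car[OF this(1)] car[OF this(2)]
  show "K_grp_action (z \<otimes>\<^bsub>K_grp (card B - 1)\<^esub> w) =
      K_grp_action z \<otimes>\<^bsub>mod_AutGroup s W\<^esub> K_grp_action w"
    unfolding mod_AutGroup_mult[OF zw]
    by (cases z; cases w)
      (simp add: K_grp_action_def mult_K_grp ev_compose[OF subspace_W] series_of_log_deriv_mult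
        series_of_tuple_add del: One_nat_def)
qed

text \<open>
  If \<open>t\<close> vanishes on \<open>B\<close>, then \<open>D f = t f\<close> makes the coefficients of \<open>f\<close> at nonzero
  exponents in \<open>B\<close> vanish, because \<open>B\<close> is closed under divisors. So the coefficients of a
  logarithmic derivative outside \<open>B\<close> do not influence the automorphism.
\<close>

lemma ev_log_deriv_vanishing:
  assumes "\<And>a. a \<in> B \<Longrightarrow> t a = 0" "v \<in> W"
    and B_divisors: "\<And>a b. a + b \<in> B \<Longrightarrow> a \<in> B"
  shows "ev (series_of_log_deriv 1 t) v = v"
proof -
  let ?f = "series_of_log_deriv 1 t"
  have t0: "t 0 = 0" using assms(1) zero_in_B by blast
  have "?f a = mps_one a" if "a \<in> B" for a
  proof (cases "a = 0")
    case False
    have "of_nat (deg a) * ?f a = (t \<star> ?f) a"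
      using has_log_deriv_series[of t 1, OF t0] by (simp add: has_log_deriv_def)
    also have "\<dots> = 0"
      unfolding cauchy_apply using assms(1) B_divisors that by (intro sum.neutral) auto
    finally show ?thesis using False by (simp add: mps_one_apply)
  qed (simp add: mps_one_apply series_of_log_deriv_0[of t, OF t0])
  then have "ev ?f v = ev mps_one v"
    using vanishing assms(2) by (intro ev_cong) blast
  then show ?thesis by (simp add: ev_one)
qed

text \<open>
  The logarithmic derivative of \<open>f\<close> is split into its part on \<open>B\<close>, which is a tuple, and its
  part outside \<open>B\<close>, which contributes the identity.
\<close>

lemma ev_in_range_K_grp_action:
  assumes "f 0 \<noteq> 0" and B_divisors: "\<And>a b. a + b \<in> B \<Longrightarrow> a \<in> B"
  shows "restrict (ev f) W \<in> K_grp_action ` carrier (K_grp (card B - 1))"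
proof -
  obtain t where t: "t 0 = 0" "f = series_of_log_deriv (f 0) t"
    using unit_eq_series_of_log_deriv[of f] assms(1) by blast
  define x where "x = (\<lambda>i\<in>{..<card B - 1}. t (inv_into (B - {0}) idx i))"
  let ?u = "\<lambda>a. t a - series_of_tuple x a"
  have x: "series_of_tuple x a = t a" if "a \<in> B" for a
    using that t(1) bij_betwE[OF bij_idx] bij_betw_inv_into_left[OF bij_idx]
    by (auto simp: series_of_tuple_def x_def)
  have "f = series_of_log_deriv (f 0) (series_of_tuple x) \<star> series_of_log_deriv 1 ?u"
    by (subst series_of_log_deriv_mult) (use t in simp_all)
  then have "ev f v = ev (series_of_log_deriv (f 0) (series_of_tuple x)) v" if "v \<in> W" for v
    using ev_log_deriv_vanishing[of ?u v] that x B_divisors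
    by (metis (no_types, lifting) ev_mult eq_iff_diff_eq_0)
  then have "restrict (ev f) W = K_grp_action (f 0, x)"
    by (auto simp: K_grp_action_def)
  moreover have "(f 0, x) \<in> carrier (K_grp (card B - 1))"
    using assms(1) by (auto simp: carrier_K_grp x_def)
  ultimately show ?thesis by blast
qed

lemma inj_on_K_grp_action:
  assumes B_divisors: "\<And>a b. a + b \<in> B \<Longrightarrow> a \<in> B"
    and faithful: "\<And>f g a. (\<And>v. v \<in> W \<Longrightarrow> ev f v = ev g v) \<Longrightarrow> a \<in> B \<Longrightarrow> f a = g a"
  shows "inj_on K_grp_action (carrier (K_grp (card B - 1)))"
proof (rule inj_onI)
  fix z w :: "'k \<times> (nat \<Rightarrow> 'k)"
  assume zw: "z \<in> carrier (K_grp (card B - 1))" "w \<in> carrier (K_grp (card B - 1))"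
    and eq: "K_grp_action z = K_grp_action w"
  obtain k x l y where z: "z = (k, x)" and w: "w = (l, y)" by (cases z; cases w)
  let ?f = "series_of_log_deriv k (series_of_tuple x)"
  let ?g = "series_of_log_deriv l (series_of_tuple y)"
  have kx: "k \<noteq> 0" "x \<in> {..<card B - 1} \<rightarrow>\<^sub>E UNIV" "y \<in> {..<card B - 1} \<rightarrow>\<^sub>E UNIV"
    using zw by (auto simp: z w carrier_K_grp)
  have "ev ?f v = ev ?g v" if "v \<in> W" for v
    using fun_cong[OF eq, of v] that by (simp add: K_grp_action_def z w)
  then have fg: "?f a = ?g a" if "a \<in> B" for a
    using faithful that by blast
  have "k = l"
    using fg[OF zero_in_B] by (simp add: series_of_log_deriv_0)
  have tuple: "series_of_tuple x a = series_of_tuple y a" if "a \<in> B" for a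
  proof (rule log_deriv_eq_on[of ?f _ ?g _ B])
    show "has_log_deriv ?f (series_of_tuple x)" "has_log_deriv ?g (series_of_tuple y)"
      by (simp_all add: has_log_deriv_series)
    show "?f 0 \<noteq> 0" using kx by (simp add: series_of_log_deriv_0)
  qed (use B_divisors fg that in blast)+
  have "x i = y i" if "i \<in> {..<card B - 1}" for i
  proof -
    have "i \<in> idx ` (B - {0})" using bij_idx that unfolding bij_betw_def by blast
    then obtain a where "a \<in> B - {0}" "idx a = i" by blast
    then show ?thesis using tuple[of a] by (simp add: series_of_tuple_def)
  qed
  then have "x = y" using kx by (intro PiE_ext)
  with \<open>k = l\<close> show "z = w" by (simp add: z w)
qed

end


section \<open>Endomorphisms of the monomial submodules\<close>

text \<open>
  The constants are the quotients of factorials \<open>(a + b)! / b!\<close>. They are nonzero because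
  the characteristic is zero.
\<close>

lemma lookup_mdiff:
  fixes a :: "'n::finite mon"
  obtains C where "\<And>b. C b \<noteq> (0 :: 'k::field_char_0)"
    and "\<And>f b. Poly_Mapping.lookup (mdiff a f) b = C b * Poly_Mapping.lookup f (b + a)"
proof -
  have "\<exists>C. (\<forall>b. C b \<noteq> (0 :: 'k)) \<and>
      (\<forall>f b. Poly_Mapping.lookup (mdiff a f) b = C b * Poly_Mapping.lookup f (b + a))"
  proof (induction a rule: mon_induct)
    case zero
    show ?case by (rule exI[of _ "\<lambda>_. 1"]) (simp add: mdiff_zero)
  next
    case (add_var a i)
    then obtain C where C: "\<And>b. C b \<noteq> (0 :: 'k)"
        "\<And>f b. Poly_Mapping.lookup (mdiff a f) b = C b * Poly_Mapping.lookup f (b + a)"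
      by blast
    let ?D = "\<lambda>b. C b * of_nat (Poly_Mapping.lookup (b + a) i + 1)"
    have "?D b \<noteq> 0" for b
      using C(1) by (simp del: of_nat_add of_nat_Suc)
    moreover have "Poly_Mapping.lookup (mdiff (a + Poly_Mapping.single i 1) f) b =
        ?D b * Poly_Mapping.lookup f (b + (a + Poly_Mapping.single i 1))" for f b
      by (simp only: mdiff_mdiff mdiff_single C(2) lookup_pdiff funpow.simps One_nat_def o_apply id_apply
          mult.assoc add.assoc)
    ultimately show ?case by (intro exI[of _ ?D]) blast
  qed
  then show ?thesis using that by blast
qed

lemma lookup_mdiff_eq_0_iff:
  fixes f :: "('n::finite, 'k::field_char_0) mpol"
  shows "Poly_Mapping.lookup (mdiff a f) b = 0 \<longleftrightarrow> Poly_Mapping.lookup f (b + a) = 0"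
  using lookup_mdiff[of a] by (metis mult_eq_0_iff)

lemma mdiff_eq_0_iff:
  fixes f :: "('n::finite, 'k::field_char_0) mpol"
  shows "mdiff a f = 0 \<longleftrightarrow> (\<forall>b. b + a \<notin> Poly_Mapping.keys f)"
  by (simp add: poly_mapping_eq_iff fun_eq_iff lookup_mdiff_eq_0_iff in_keys_iff)

lemma Tn_monomial: "Tn (monomial a) f = mdiff a f"
  by (simp add: monomial_def Tn_single)

lemma Tn_Const_monomial: "Tn (Const c * monomial a) f = Const c * mdiff a f"
  by (simp add: Tn_mult Tn_Const Tn_monomial)

lemma Tn_minus_right: "Tn p (f - g) = Tn p f - Tn p g" for f g :: "('n::finite, 'k::comm_ring_1) mpol"
  using Tn_add_right[of p "f - g" g] by (simp add: algebra_simps)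

interpretation Tn: locally_nilpotent_module
  "Tn :: ('n::finite, 'k::field_char_0) mpol \<Rightarrow> _" monomial
proof (intro locally_nilpotent_module.intro module_Tn locally_nilpotent_module_axioms.intro)
  show "monomial 0 = (1 :: ('n, 'k) mpol)"
    by (simp add: monomial_def)
  show "monomial (a + b) = (monomial a * monomial b :: ('n, 'k) mpol)" for a b
    by (simp add: monomial_def mult_single)
  fix f :: "('n, 'k) mpol"
  have "{a. Tn (monomial a) f \<noteq> 0} \<subseteq> (\<Union>c\<in>Poly_Mapping.keys f. snd ` {(a, b). a + b = c})"
    by (force simp: Tn_monomial mdiff_eq_0_iff)
  then show "finite {a. Tn (monomial a) f \<noteq> 0}"
    by (rule finite_subset) (auto simp: finite_mon_antidiagonal)
qed

definition mon_supported :: "'n::finite mon set \<Rightarrow> ('n, 'k::field_char_0) mpol set" where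
  "mon_supported B = {f. Poly_Mapping.keys f \<subseteq> B}"

lemma monomial_in_mon_supported: "a \<in> B \<Longrightarrow> monomial a \<in> mon_supported B"
  by (simp add: mon_supported_def monomial_def)

text \<open>
  At \<open>0\<close> the only derivative of \<open>x\<^sup>a\<close> that does not vanish is \<open>\<partial>\<^sup>a x\<^sup>a\<close>.
\<close>

lemma lookup_ev_monomial:
  fixes f :: "('n::finite, 'k::field_char_0) mps"
  shows "Poly_Mapping.lookup (Tn.ev f (monomial a)) 0 =
    f a * Poly_Mapping.lookup (mdiff a (monomial a)) 0"
proof -
  have "Poly_Mapping.lookup (Tn.ev f (monomial a)) 0 =
      (\<Sum>b\<in>Tn.supp (monomial a :: ('n, 'k) mpol). f b * Poly_Mapping.lookup (mdiff b (monomial a)) 0)"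
    by (simp add: Tn.ev_def Tn_Const_monomial lookup_sum lookup_Const_times)
  also have "\<dots> = (\<Sum>b\<in>{a}. f b * Poly_Mapping.lookup (mdiff b (monomial a)) 0)"
  proof (rule sum.mono_neutral_cong)
    show "f b * Poly_Mapping.lookup (mdiff b (monomial a)) 0 = 0"
      if "b \<in> Tn.supp (monomial a :: ('n, 'k) mpol) - {a}" for b
    proof -
      have "Poly_Mapping.lookup (mdiff b (monomial a)) 0 = (0 :: 'k)"
        using that by (simp add: lookup_mdiff_eq_0_iff) (simp add: monomial_def lookup_single when_def, blast)
      then show ?thesis by simp
    qed
  qed (use Tn.locally_nilpotent[of "monomial a :: ('n, 'k) mpol"] in \<open>auto simp: Tn_monomial\<close>)
  finally show ?thesis by simp
qed

lemma lookup_mdiff_monomial_ne_0: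
  fixes a :: "'n::finite mon"
  shows "Poly_Mapping.lookup (mdiff a (monomial a)) 0 \<noteq> (0 :: 'k::field_char_0)"
  by (simp add: lookup_mdiff_eq_0_iff monomial_def)

lemma ev_faithful:
  fixes f g :: "('n::finite, 'k::field_char_0) mps"
  assumes "\<And>v. v \<in> mon_supported B \<Longrightarrow> Tn.ev f v = Tn.ev g v" "a \<in> B"
  shows "f a = g a"
proof -
  have "Tn.ev f (monomial a) = Tn.ev g (monomial a)"
    using assms by (simp add: monomial_in_mon_supported)
  then have "f a * Poly_Mapping.lookup (mdiff a (monomial a)) 0 =
      g a * Poly_Mapping.lookup (mdiff a (monomial a)) 0"
    by (simp only: lookup_ev_monomial[symmetric])
  then show ?thesis using lookup_mdiff_monomial_ne_0[of a, where ?'k = 'k] by simp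
qed

locale order_ideal =
  fixes B :: "'n::finite mon set"
  assumes divisors: "a + b \<in> B \<Longrightarrow> a \<in> B"
begin

lemma divisors_right: "b + a \<in> B \<Longrightarrow> a \<in> B"
  using divisors[of a b] by (simp add: add.commute)

lemma subspace_mon_supported:
  "Tn.subspace (mon_supported B :: ('n, 'k::field_char_0) mpol set)"
proof (rule Tn.subspaceI)
  show add: "f + g \<in> mon_supported B" if "f \<in> mon_supported B" "g \<in> mon_supported B"
    for f g :: "('n, 'k) mpol"
    using that keys_add[of f g] by (auto simp: mon_supported_def)
  show zero: "(0 :: ('n, 'k) mpol) \<in> mon_supported B"
    by (simp add: mon_supported_def)
  fix p f :: "('n, 'k) mpol" assume f: "f \<in> mon_supported B"
  have "Const c * mdiff a f \<in> mon_supported B" for c a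
    using f divisors
    by (auto simp: mon_supported_def in_keys_iff lookup_Const_times lookup_mdiff_eq_0_iff subset_iff)
  then have "(\<Sum>a\<in>A. Const (Poly_Mapping.lookup p a) * mdiff a f) \<in> mon_supported B" for A
    by (induction A rule: infinite_finite_induct) (simp_all add: zero add)
  then show "Tn p f \<in> mon_supported B"
    unfolding Tn_def .
qed

text \<open>
  The coefficients of \<open>f\<close> are chosen such that \<open>\<phi>(v)\<close> and the image of \<open>v\<close> under \<open>f\<close> have
  the same constant term for monomials \<open>v\<close>, hence for all \<open>v\<close>. Applying this to the
  derivatives of \<open>v\<close>, with which both maps commute, shows that the two images have the same
  derivatives at \<open>0\<close> and are therefore equal.
\<close>

lemma endomorphism_eq_ev:
  fixes \<phi> :: "('n, 'k::field_char_0) mpol \<Rightarrow> ('n, 'k) mpol"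
  assumes \<phi>: "\<phi> \<in> mod_End Tn (mon_supported B)"
  obtains f where "\<phi> = restrict (Tn.ev f) (mon_supported B)"
proof -
  let ?M = "mon_supported B :: ('n, 'k) mpol set"
  have add: "\<phi> (u + v) = \<phi> u + \<phi> v" if "u \<in> ?M" "v \<in> ?M" for u v
    using \<phi> that by (simp add: mod_End_def)
  have scale: "\<phi> (Tn p v) = Tn p (\<phi> v)" if "v \<in> ?M" for p v
    using \<phi> that by (simp add: mod_End_def)
  have zero: "0 \<in> ?M" "\<phi> 0 = 0"
    using add[of 0 0] by (simp_all add: mon_supported_def)
  define f :: "('n, 'k) mps" where
    "f a = Poly_Mapping.lookup (\<phi> (monomial a)) 0 / Poly_Mapping.lookup (mdiff a (monomial a)) 0" for a
  have mono: "Poly_Mapping.lookup (\<phi> (Const c * monomial a)) 0 =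
      Poly_Mapping.lookup (Tn.ev f (Const c * monomial a)) 0" if "a \<in> B" for a c
  proof -
    have "\<phi> (Const c * monomial a) = Const c * \<phi> (monomial a)"
      using scale[of "monomial a" "Const c"] that by (simp add: Tn_Const monomial_in_mon_supported)
    moreover have "Tn.ev f (Const c * monomial a) = Const c * Tn.ev f (monomial a)"
      using Tn.ev_scale[of f "Const c" "monomial a"] by (simp only: Tn_Const)
    ultimately show ?thesis
      using lookup_mdiff_monomial_ne_0[of a, where ?'k = 'k]
      by (simp add: lookup_Const_times lookup_ev_monomial f_def)
  qed
  have const: "Poly_Mapping.lookup (\<phi> v) 0 = Poly_Mapping.lookup (Tn.ev f v) 0" if v: "v \<in> ?M" for v
  proof -
    let ?t = "\<lambda>a. Const (Poly_Mapping.lookup v a) * monomial a"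
    have sums: "A \<subseteq> B \<Longrightarrow> sum ?t A \<in> ?M \<and>
        Poly_Mapping.lookup (\<phi> (sum ?t A)) 0 = Poly_Mapping.lookup (Tn.ev f (sum ?t A)) 0"
      if "finite A" for A
      using that
    proof (induction rule: finite_induct)
      case empty
      then show ?case using zero by (simp add: Tn.ev_def)
    next
      case (insert a A)
      have "?t a \<in> ?M"
        using Tn.subspace_scale[OF subspace_mon_supported, of "monomial a" "Const (Poly_Mapping.lookup v a)"] insert
        by (simp add: Tn_Const monomial_in_mon_supported)
      then show ?case
        using insert mono[of a] subspace_mon_supported[where ?'k = 'k]
        by (simp add: add Tn.ev_add lookup_add Tn.subspace_add)
    qed
    have v_eq: "v = sum ?t (Poly_Mapping.keys v)"
      by (rule trans[OF mpol_eq_sum_single]) (simp add: Const_def monomial_def mult_single)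
    have "Poly_Mapping.keys v \<subseteq> B"
      using v by (simp add: mon_supported_def)
    from sums[OF finite_keys this] show ?thesis
      unfolding v_eq[symmetric] by blast
  qed
  have "\<phi> v = Tn.ev f v" if v: "v \<in> ?M" for v
  proof -
    have "Poly_Mapping.lookup (\<phi> v - Tn.ev f v) b = 0" for b
    proof -
      have "mdiff b (\<phi> v - Tn.ev f v) = \<phi> (mdiff b v) - Tn.ev f (mdiff b v)"
        using scale[OF v, of "monomial b"] Tn.ev_scale[of f "monomial b" v]
        by (simp add: Tn_monomial[symmetric] Tn_minus_right)
      moreover have "mdiff b v \<in> ?M"
        using Tn.subspace_scale[OF subspace_mon_supported v, of "monomial b"] by (simp add: Tn_monomial)
      ultimately have "Poly_Mapping.lookup (mdiff b (\<phi> v - Tn.ev f v)) 0 = 0"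
        using const by (simp add: lookup_minus)
      then show ?thesis by (simp add: lookup_mdiff_eq_0_iff)
    qed
    then have "\<phi> v - Tn.ev f v = 0" by (intro poly_mapping_eqI) simp
    then show ?thesis by simp
  qed
  moreover have "\<phi> \<in> extensional ?M"
    using \<phi> by (auto simp: mod_End_def PiE_def)
  ultimately have "\<phi> = restrict (Tn.ev f) ?M"
    by (intro extensionalityI[of _ ?M]) auto
  then show ?thesis by (rule that)
qed

end

lemma mon_supported_UNIV: "mon_supported UNIV = UNIV"
  by (simp add: mon_supported_def)

lemma endomorphism_Tn_eq_ev:
  fixes \<phi> :: "('n::finite, 'k::field_char_0) mpol \<Rightarrow> ('n, 'k) mpol"
  assumes "\<phi> \<in> mod_End Tn UNIV"
  obtains f where "\<phi> = Tn.ev f"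
proof -
  interpret order_ideal "UNIV :: 'n mon set" by unfold_locales simp
  show ?thesis
    using endomorphism_eq_ev[of \<phi>] assms that by (auto simp: mon_supported_UNIV restrict_def)
qed

lemma ev_in_mod_End_Tn: "Tn.ev f \<in> mod_End Tn UNIV"
  using Tn.ev_in_mod_End[of UNIV f] by (simp add: Tn.subspace_UNIV restrict_def)

lemma inj_ev_Tn:
  fixes f g :: "('n::finite, 'k::field_char_0) mps"
  assumes "Tn.ev f = Tn.ev g"
  shows "f = g"
proof
  show "f a = g a" for a
    by (rule ev_faithful[of UNIV]) (simp_all add: assms)
qed

lemma ev_ring_iso:
  "Tn.ev \<in> ring_iso (mps_algebra :: ('k::field_char_0, 'n::finite mon \<Rightarrow> 'k) module)
     (mod_End_algebra Tn UNIV)"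
proof -
  have "Tn.ev \<in> ring_hom (mps_algebra :: ('k, 'n mon \<Rightarrow> 'k) module) (mod_End_algebra Tn UNIV)"
  proof (rule ring_hom_memI)
    fix f g :: "('n, 'k) mps"
    show "Tn.ev f \<in> carrier (mod_End_algebra Tn UNIV)"
      by (simp add: mod_End_algebra_def ev_in_mod_End_Tn)
    show "Tn.ev (f \<star> g) = Tn.ev f \<otimes>\<^bsub>mod_End_algebra Tn UNIV\<^esub> Tn.ev g"
      by (simp add: mod_End_algebra_def compose_def fun_eq_iff Tn.ev_mult)
    show "Tn.ev (f \<oplus>\<^bsub>mps_algebra\<^esub> g) = Tn.ev f \<oplus>\<^bsub>mod_End_algebra Tn UNIV\<^esub> Tn.ev g"
      by (simp add: mod_End_algebra_def mps_algebra_def fun_eq_iff Tn.ev_series_add)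
    show "Tn.ev mps_one = \<one>\<^bsub>mod_End_algebra Tn (UNIV :: ('n, 'k) mpol set)\<^esub>"
      by (simp add: mod_End_algebra_def fun_eq_iff Tn.ev_one)
  qed
  moreover have "bij_betw Tn.ev (UNIV :: ('n, 'k) mps set) (mod_End Tn UNIV)"
    unfolding bij_betw_def
  proof
    show "inj (Tn.ev :: ('n, 'k) mps \<Rightarrow> _)" by (rule injI) (rule inj_ev_Tn)
    show "range (Tn.ev :: ('n, 'k) mps \<Rightarrow> _) = mod_End Tn UNIV"
    proof (intro equalityI subsetI)
      fix \<phi> :: "('n, 'k) mpol \<Rightarrow> ('n, 'k) mpol" assume "\<phi> \<in> mod_End Tn UNIV"
      then show "\<phi> \<in> range Tn.ev" by (elim endomorphism_Tn_eq_ev) (rule range_eqI)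
    qed (auto simp: ev_in_mod_End_Tn)
  qed
  ultimately show ?thesis
    by (simp add: ring_iso_def mod_End_algebra_def)
qed

theorem End_Tn_isomorphic:
  "alg_isomorphic (mod_End_algebra Tn (UNIV :: ('n, 'k) mpol set))
     (mps_algebra :: ('k::field_char_0, 'n::finite mon \<Rightarrow> 'k) module)"
proof -
  let ?S = "mps_algebra :: ('k, 'n mon \<Rightarrow> 'k) module"
  let ?E = "mod_End_algebra Tn (UNIV :: ('n, 'k) mpol set)"
  let ?h = "inv_into UNIV (Tn.ev :: ('n, 'k) mps \<Rightarrow> _)"
  have "ring ?S" by (rule cring.axioms(1)[OF cring_mps])
  from ring_iso_set_sym[OF this ev_ring_iso] have "?h \<in> ring_iso ?E ?S" by simp
  moreover have h_ev: "?h (Tn.ev f) = f" for f :: "('n, 'k) mps"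
    by (rule inv_into_f_f[OF injI]) (rule inj_ev_Tn, simp_all)
  have "?h (c \<odot>\<^bsub>?E\<^esub> \<phi>) = c \<odot>\<^bsub>?S\<^esub> ?h \<phi>" if phi: "\<phi> \<in> carrier ?E" for c \<phi>
  proof -
    obtain f where f: "\<phi> = Tn.ev f"
      using phi by (auto simp: mod_End_algebra_def intro: endomorphism_Tn_eq_ev[of \<phi>])
    have "c \<odot>\<^bsub>?E\<^esub> \<phi> = Tn.ev (\<lambda>a. c * f a)"
      by (simp add: mod_End_algebra_def fun_eq_iff f kscale_def Tn.ev_series_smult)
    then show ?thesis
      by (simp only: f h_ev) (simp add: mps_algebra_def)
  qed
  ultimately show ?thesis unfolding alg_isomorphic_def by blast
qed

lemma mod_AutGroup_UNIV:
  "\<phi> \<in> carrier (mod_AutGroup s UNIV) \<longleftrightarrow> \<phi> \<in> mod_End s UNIV \<and> bij \<phi>"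
  by (simp add: mod_AutGroup_def Bij_def)

theorem Aut_Tn_isomorphic:
  "mod_AutGroup Tn (UNIV :: ('n, 'k) mpol set) \<cong> units_of (mps_algebra :: ('k::field_char_0, 'n::finite mon \<Rightarrow> 'k) module)"
proof -
  let ?S = "mps_algebra :: ('k, 'n mon \<Rightarrow> 'k) module"
  let ?A = "mod_AutGroup Tn (UNIV :: ('n, 'k) mpol set)"
  interpret S: cring ?S by (rule cring_mps)
  have aut: "Tn.ev f \<in> carrier ?A" if unit: "f \<in> Units ?S" for f
  proof -
    obtain g where "f \<star> g = mps_one" using unit by (auto simp: Units_def)
    from Tn.ev_bij[OF Tn.subspace_UNIV this] show ?thesis by (simp add: restrict_def)
  qed
  have "Tn.ev \<in> hom (units_of ?S) ?A"
  proof (rule homI)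
    fix f g assume fg: "f \<in> carrier (units_of ?S)" "g \<in> carrier (units_of ?S)"
    then show "Tn.ev f \<in> carrier ?A" by (simp add: aut units_of_carrier)
    show "Tn.ev (f \<otimes>\<^bsub>units_of ?S\<^esub> g) = Tn.ev f \<otimes>\<^bsub>?A\<^esub> Tn.ev g"
      using fg by (simp add: mod_AutGroup_mult aut units_of_carrier units_of_mult compose_def fun_eq_iff Tn.ev_mult)
  qed
  moreover have "bij_betw Tn.ev (carrier (units_of ?S)) (carrier ?A)"
    unfolding bij_betw_def
  proof
    show "inj_on Tn.ev (carrier (units_of ?S))" by (rule inj_onI) (rule inj_ev_Tn)
    show "Tn.ev ` carrier (units_of ?S) = carrier ?A"
    proof (intro equalityI subsetI)
      fix \<phi> assume phi: "\<phi> \<in> carrier ?A"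
      interpret A: group ?A by (rule group_mod_AutGroup[OF module_Tn Tn.subspace_UNIV])
      define \<psi> where "\<psi> = inv\<^bsub>?A\<^esub> \<phi>"
      have psi: "\<psi> \<in> carrier ?A" using phi by (simp add: \<psi>_def)
      obtain f where f: "\<phi> = Tn.ev f"
        using phi endomorphism_Tn_eq_ev[of \<phi>] by (auto simp: mod_AutGroup_UNIV)
      obtain g where g: "\<psi> = Tn.ev g"
        using psi endomorphism_Tn_eq_ev[of \<psi>] by (auto simp: mod_AutGroup_UNIV)
      have "compose UNIV \<phi> \<psi> = \<one>\<^bsub>?A\<^esub>"
        using phi by (simp add: \<psi>_def flip: mod_AutGroup_mult)
      then have "Tn.ev (f \<star> g) = Tn.ev mps_one"
        by (simp add: f g compose_def mod_AutGroup_def BijGroup_def fun_eq_iff Tn.ev_mult Tn.ev_one)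
      then have "f \<star> g = mps_one" by (rule inj_ev_Tn)
      then have "f \<in> Units ?S"
        using cauchy_commute[of f g] by (auto simp: Units_def)
      then show "\<phi> \<in> Tn.ev ` carrier (units_of ?S)"
        by (simp add: f units_of_carrier)
    qed (auto simp: aut units_of_carrier)
  qed
  ultimately have "units_of ?S \<cong> ?A"
    by (auto simp: is_iso_def iso_def)
  then show ?thesis
    by (rule group.iso_sym[OF S.units_group])
qed

text \<open>
  An injective endomorphism does not annihilate the constant polynomial \<open>1\<close>, on which a power
  series acts as its constant term. So automorphisms come from power series with nonzero
  constant term.
\<close>

lemma (in order_ideal) Aut_mon_supported_isomorphic:
  assumes "finite B" "B \<noteq> {}"
  shows "mod_AutGroup Tn (mon_supported B :: ('n, 'k) mpol set) \<cong>
    (K_grp (card B - 1) :: ('k::field_char_0 \<times> (nat \<Rightarrow> 'k)) monoid)"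
proof -
  let ?M = "mon_supported B :: ('n, 'k) mpol set"
  let ?K = "K_grp (card B - 1) :: ('k \<times> (nat \<Rightarrow> 'k)) monoid"
  have zero: "0 \<in> B" using assms(2) divisors[of 0] by auto
  have "card (B - {0}) = card B - 1" using zero by (rule card_Diff_singleton)
  then obtain idx where idx: "bij_betw idx (B - {0}) {..<card B - 1}"
    using assms(1) ex_bij_betw_finite_nat[of "B - {0}"] by (auto simp: atLeast0LessThan)
  interpret W: finite_support_submodule "Tn :: ('n, 'k) mpol \<Rightarrow> _" monomial ?M B idx
  proof unfold_locales
    show "Tn.subspace ?M" by (rule subspace_mon_supported)
    show "Tn (monomial a) v = 0" if "a \<notin> B" "v \<in> ?M" for a v
      using that divisors_right by (auto simp: Tn_monomial mdiff_eq_0_iff mon_supported_def)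
  qed (fact zero idx)+
  have "W.K_grp_action ` carrier ?K = carrier (mod_AutGroup Tn ?M)"
  proof (intro equalityI subsetI)
    fix \<phi> assume phi: "\<phi> \<in> carrier (mod_AutGroup Tn ?M)"
    then obtain f where f: "\<phi> = restrict (Tn.ev f) ?M"
      using endomorphism_eq_ev[of \<phi>] by (auto simp: mod_AutGroup_def)
    have "f 0 \<noteq> 0"
    proof
      assume "f 0 = 0"
      have "Tn.ev f (monomial 0) = 0"
        by (subst Tn.ev_single[of 0])
          (use \<open>f 0 = 0\<close> in \<open>auto simp: Tn_monomial mdiff_eq_0_iff mon_add_eq_0_iff, simp add: monomial_def mon_add_eq_0_iff\<close>)
      moreover have "Tn.ev f 0 = 0" by (simp add: Tn.ev_def)
      moreover have "monomial 0 \<in> ?M" "0 \<in> ?M"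
        using zero monomial_in_mon_supported[of 0 B, where ?'b = 'k] by (simp_all add: mon_supported_def)
      moreover have "inj_on \<phi> ?M"
        using phi by (auto simp: mod_AutGroup_def Bij_def bij_betw_def)
      ultimately have "monomial 0 = (0 :: ('n, 'k) mpol)"
        by (auto simp: f inj_on_def)
      then show False by (simp add: monomial_def)
    qed
    then show "\<phi> \<in> W.K_grp_action ` carrier ?K"
      unfolding f using divisors by (rule W.ev_in_range_K_grp_action)
  qed (use W.K_grp_action_hom in \<open>auto simp: hom_def\<close>)
  moreover have "inj_on W.K_grp_action (carrier ?K)"
    using divisors ev_faithful by (rule W.inj_on_K_grp_action)
  ultimately have "?K \<cong> mod_AutGroup Tn ?M"
    using W.K_grp_action_hom by (auto simp: is_iso_def iso_def bij_betw_def)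
  then show ?thesis by (rule group.iso_sym[OF group_K_grp])
qed

text \<open>
  The exponents of a monomial basis are closed under divisors, since differentiating a
  monomial leads to nonzero multiples of all monomials dividing it.
\<close>

lemma monomial_submodule_eq_mon_supported:
  fixes M :: "('n::finite, 'k::field_char_0) mpol set"
  assumes M: "monomial_submodule M"
  obtains B where "order_ideal B" "M = mon_supported B" "kdim Tn M = card B"
proof -
  interpret K: vector_space "kscale (Tn :: ('n, 'k) mpol \<Rightarrow> _)"
    by (rule vector_space_kscale[OF module_Tn])
  have sub: "Tn.subspace M" using M by (simp add: monomial_submodule_def)
  obtain S where S: "S \<subseteq> range monomial" "K.independent S" "K.span S = M"
    using M by (auto simp: monomial_submodule_def)
  define B where "B = {a. monomial a \<in> S}"
  have SB: "S = monomial ` B" using S(1) by (auto simp: B_def)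
  have inj: "inj (monomial :: _ \<Rightarrow> ('n, 'k) mpol)"
    by (rule injI) (auto simp: monomial_def poly_mapping_eq_iff fun_eq_iff lookup_single when_def split: if_splits)
  have scaled: "kscale Tn c v = Const c * v" for c and v :: "('n, 'k) mpol"
    by (simp add: kscale_def Tn_Const)
  have "M \<subseteq> mon_supported B"
  proof -
    have "K.subspace (mon_supported B)"
    proof -
      have "mon_supported B = {f :: ('n, 'k) mpol. \<forall>a. a \<notin> B \<longrightarrow> Poly_Mapping.lookup f a = 0}"
        by (auto simp: mon_supported_def in_keys_iff subset_iff)
      then show ?thesis
        by (auto intro!: K.subspaceI simp: scaled lookup_Const_times lookup_add)
    qed
    moreover have "S \<subseteq> mon_supported B"
      by (auto simp: SB monomial_in_mon_supported)
    ultimately show ?thesis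
      using K.span_minimal S(3) by blast
  qed
  moreover have "mon_supported B \<subseteq> M"
  proof
    fix f :: "('n, 'k) mpol" assume f: "f \<in> mon_supported B"
    have "f = (\<Sum>a\<in>Poly_Mapping.keys f. kscale Tn (Poly_Mapping.lookup f a) (monomial a))"
      by (rule trans[OF mpol_eq_sum_single]) (simp add: scaled Const_def monomial_def mult_single)
    also have "\<dots> \<in> M"
      unfolding S(3)[symmetric] using f
      by (intro K.span_sum K.span_scale K.span_base) (auto simp: mon_supported_def SB)
    finally show "f \<in> M" .
  qed
  ultimately have M_eq: "M = mon_supported B" by blast
  have "order_ideal B"
  proof
    fix a b assume ab: "a + b \<in> B"
    let ?d = "mdiff b (monomial (a + b)) :: ('n, 'k) mpol"
    have "monomial (a + b) \<in> M" using ab by (simp add: M_eq monomial_in_mon_supported)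
    then have "?d \<in> M"
      using Tn.subspace_scale[OF sub, of "monomial (a + b)" "monomial b"] by (simp add: Tn_monomial)
    moreover have "Poly_Mapping.lookup ?d a \<noteq> 0"
      by (simp add: lookup_mdiff_eq_0_iff monomial_def)
    ultimately show "a \<in> B" by (auto simp: M_eq mon_supported_def in_keys_iff)
  qed
  moreover have "kdim Tn M = card B"
    unfolding kdim_def using S(2,3) card_image[OF inj_on_subset[OF inj], of B]
    by (subst K.dim_eq_card[of S]) (auto simp: SB K.span_span)
  ultimately show ?thesis using M_eq that by blast
qed

theorem Aut_monomial_submodule_isomorphic:
  fixes M :: "('n::finite, 'k::field_char_0) mpol set"
  assumes "monomial_submodule M" "kdim Tn M = m" "m \<ge> 1"
  shows "mod_AutGroup Tn M \<cong> (K_grp (m - 1) :: ('k \<times> (nat \<Rightarrow> 'k)) monoid)"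
proof -
  obtain B where B: "order_ideal B" "M = mon_supported B" "kdim Tn M = card B"
    using monomial_submodule_eq_mon_supported[OF assms(1)] .
  then have "card B > 0" "card B = m" using assms by simp_all
  then show ?thesis
    using order_ideal.Aut_mon_supported_isomorphic[OF B(1)] B(2) by (auto simp: card_gt_0_iff)
qed


section \<open>Modules with one-dimensional socle\<close>

text \<open>
  In finite dimension a separating linear space of functionals contains all functionals. The
  proof is by induction on the independent set: functionals dual to \<open>S\<close> are used to remove from
  the new vector \<open>v\<close> a combination of \<open>S\<close>, and a functional that is nonzero on the
  remainder is corrected such that it vanishes on \<open>S\<close>.
\<close>

lemma (in vector_space) separating_functionals_interpolate:
  fixes E :: "('b \<Rightarrow> 'a) set"
  assumes zero: "(\<lambda>_. 0) \<in> E"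
    and add: "\<And>e f. e \<in> E \<Longrightarrow> f \<in> E \<Longrightarrow> (\<lambda>v. e v + f v) \<in> E"
    and smult: "\<And>c e. e \<in> E \<Longrightarrow> (\<lambda>v. c * e v) \<in> E"
    and linear_add: "\<And>e u v. e \<in> E \<Longrightarrow> e (u + v) = e u + e v"
    and linear_scale: "\<And>e c v. e \<in> E \<Longrightarrow> e (scale c v) = c * e v"
    and separating: "\<And>v. v \<noteq> 0 \<Longrightarrow> \<exists>e\<in>E. e v \<noteq> 0"
    and "finite S" "\<not> dependent S"
  shows "\<exists>e\<in>E. \<forall>x\<in>S. e x = g x"
  using \<open>finite S\<close> \<open>\<not> dependent S\<close>
proof (induction S arbitrary: g rule: finite_induct)
  case empty
  then show ?case using zero by blast
next
  case (insert v S)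
  have zero_at: "e 0 = 0" if "e \<in> E" for e
    using linear_scale[OF that, of 0 0] by simp
  have sum_closed: "(\<lambda>v. \<Sum>x\<in>A. c x * e x v) \<in> E" if "finite A" "\<And>x. x \<in> A \<Longrightarrow> e x \<in> E"
    for A :: "'b set" and c e
    using that by (induction rule: finite_induct) (simp_all add: zero add smult)
  have linear_sum: "e (\<Sum>x\<in>A. scale (c x) x) = (\<Sum>x\<in>A. c x * e x)" if "finite A" "e \<in> E"
    for A c e
    using that by (induction rule: finite_induct) (simp_all add: zero_at linear_add linear_scale)
  have v: "v \<notin> span S" and S: "\<not> dependent S"
    using insert.prems insert.hyps by (simp_all add: independent_insert)
  have "\<exists>d. \<forall>x\<in>S. d x \<in> E \<and> (\<forall>y\<in>S. d x y = (if y = x then 1 else 0))"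
    using insert.IH[OF S, of "\<lambda>y. if y = x then 1 else 0" for x] by (intro bchoice) blast
  then obtain d where d: "\<And>x. x \<in> S \<Longrightarrow> d x \<in> E"
      and dual: "\<And>x y. x \<in> S \<Longrightarrow> y \<in> S \<Longrightarrow> d x y = (if y = x then 1 else 0)"
    by blast
  \<comment> \<open>the part of \<open>v\<close> on which all the dual functionals vanish\<close>
  define w where "w = v - (\<Sum>x\<in>S. scale (d x v) x)"
  have w: "v = w + (\<Sum>x\<in>S. scale (d x v) x)" by (simp add: w_def)
  have "w \<noteq> 0"
  proof
    assume "w = 0"
    then have "v = (\<Sum>x\<in>S. scale (d x v) x)" using w by simp
    also have "\<dots> \<in> span S" by (intro span_sum span_scale span_base)
    finally show False using v by blast
  qed
  then obtain q where q: "q \<in> E" "q w \<noteq> 0" using separating by blast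
  define e where "e u = q u + (-1) * (\<Sum>x\<in>S. q x * d x u)" for u
  have eE: "e \<in> E"
    unfolding e_def using sum_closed[OF insert.hyps(1) d] q(1) by (intro add smult) auto
  have e_S: "e y = 0" if y: "y \<in> S" for y
  proof -
    have "(\<Sum>x\<in>S. q x * d x y) = (\<Sum>x\<in>S. if x = y then q x else 0)"
      using y by (intro sum.cong) (auto simp: dual)
    then show ?thesis using y insert.hyps(1) by (simp add: e_def)
  qed
  have "e v = q w"
  proof -
    have "q v = q (w + (\<Sum>x\<in>S. scale (d x v) x))"
      using w by (rule arg_cong)
    also have "\<dots> = q w + (\<Sum>x\<in>S. d x v * q x)"
      by (simp only: linear_add[OF q(1)] linear_sum[OF insert.hyps(1) q(1)])
    finally show ?thesis by (simp add: e_def mult.commute)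
  qed
  then have ev: "e v \<noteq> 0" using q by simp
  obtain f where f: "f \<in> E" "\<And>x. x \<in> S \<Longrightarrow> f x = g x" using insert.IH[OF S] by blast
  let ?h = "\<lambda>u. f u + ((g v - f v) / e v) * e u"
  have "?h \<in> E" using f eE by (intro add smult)
  moreover have "\<forall>x\<in>insert v S. ?h x = g x" using f e_S ev by simp
  ultimately show ?case by (intro bexI[of _ ?h])
qed

text \<open>
  What is used about a one-dimensional socle: it is spanned by a common eigenvector of the
  variables that lies in every nonzero submodule.
\<close>

locale essential_line_module = Modules.module s
  for s :: "('n::finite, 'k::field) mpol \<Rightarrow> 'm::ab_group_add \<Rightarrow> 'm" +
  fixes v\<^sub>0 :: 'm and \<mu> :: "'n \<Rightarrow> 'k"
  assumes finite_dimensional: "fin_dim s UNIV"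
    and v\<^sub>0_nonzero: "v\<^sub>0 \<noteq> 0"
    and essential: "subspace W \<Longrightarrow> W \<noteq> {0} \<Longrightarrow> v\<^sub>0 \<in> W"
    and eigenvector: "s (Var i) v\<^sub>0 = s (Const (\<mu> i)) v\<^sub>0"
begin

sublocale K: vector_space "kscale s"
  by (rule vector_space_kscale) (rule module_axioms)

declare scale_scale [simp del]

lemma finite_basis:
  obtains S where "finite S" "\<not> K.dependent S" "K.span S = UNIV"
proof -
  obtain A where A: "finite A" "K.span A = UNIV"
    using finite_dimensional by (auto simp: fin_dim_def)
  obtain S where S: "S \<subseteq> A" "\<not> K.dependent S" "A \<subseteq> K.span S"
    by (rule K.maximal_independent_subset)
  have "K.span A \<subseteq> K.span S" by (rule K.span_minimal[OF S(3) K.subspace_span])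
  then show ?thesis
    using that[of S] A S finite_subset[OF S(1)] by blast
qed

text \<open>
  For large \<open>k\<close> the kernels of the powers \<open>y\<^sup>k\<close> of \<open>y = x\<^sub>i - \<mu>\<^sub>i\<close> are stationary, and then the
  submodule \<open>im y\<^sup>k\<close> meets \<open>ker y\<close> only in zero. As \<open>v\<^sub>0\<close> lies in \<open>ker y\<close>, it does not lie
  in \<open>im y\<^sup>k\<close>, which is thus zero.
\<close>

lemma shifted_variable_nilpotent: "\<exists>k. \<forall>v. s ((Var i - Const (\<mu> i)) ^ k) v = 0"
proof -
  obtain S where S: "finite S" "\<not> K.dependent S" "K.span S = UNIV"
    by (rule finite_basis)
  interpret K: finite_dimensional_vector_space "kscale s" S
    using S by unfold_locales
  let ?y = "Var i - Const (\<mu> i)"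
  let ?N = "\<lambda>k. {v. s (?y ^ k) v = 0}"
  have sub: "K.subspace (?N k)" for k
    by (rule K.subspaceI) (auto simp: scale_right_distrib kscale_def scale_left_commute)
  have mono: "?N k \<subseteq> ?N (Suc k)" for k
    by (auto simp: scale_scale[symmetric])
  have "\<exists>k. True \<and> (\<forall>l. True \<longrightarrow> K.dim (?N l) \<le> K.dim (?N k))"
    by (rule ex_has_greatest_nat[where k = 0 and b = "Suc (K.dim UNIV)"])
      (simp_all only: TrueI simp_thms less_Suc_eq_le K.dim_subset subset_UNIV)
  then obtain k where "K.dim (?N (Suc k)) \<le> K.dim (?N k)" by blast
  then have eq: "?N (Suc k) = ?N k"
    by (rule K.subspace_dim_equal[OF sub sub mono, symmetric])
  let ?W = "range (s (?y ^ k))"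
  have "subspace ?W"
  proof (rule subspaceI)
    show "0 \<in> ?W" by (rule image_eqI[of _ _ 0]) simp_all
    show "u + v \<in> ?W" if "u \<in> ?W" "v \<in> ?W" for u v
      using that by (auto simp flip: scale_right_distrib)
    show "s p v \<in> ?W" if "v \<in> ?W" for p v
      using that by (auto simp: scale_left_commute[of p])
  qed
  moreover have "v\<^sub>0 \<notin> ?W"
  proof
    assume "v\<^sub>0 \<in> ?W"
    then obtain w where w: "v\<^sub>0 = s (?y ^ k) w" by blast
    have "s ?y v\<^sub>0 = 0" using eigenvector by (simp add: scale_left_diff_distrib)
    then have "w \<in> ?N (Suc k)" by (simp add: w scale_scale)
    then show False using eq w v\<^sub>0_nonzero by auto
  qed
  ultimately have "?W = {0}" using essential by blast
  then show ?thesis by blast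
qed

definition shifted_monomial :: "'n mon \<Rightarrow> ('n, 'k) mpol" where
  "shifted_monomial a = (\<Prod>i\<in>UNIV. (Var i - Const (\<mu> i)) ^ Poly_Mapping.lookup a i)"

lemma shifted_monomial_zero: "shifted_monomial 0 = 1"
  by (simp add: shifted_monomial_def)

lemma shifted_monomial_add: "shifted_monomial (a + b) = shifted_monomial a * shifted_monomial b"
  by (simp add: shifted_monomial_def lookup_add power_add prod.distrib)

lemma shifted_monomial_single:
  "shifted_monomial (Poly_Mapping.single i 1) = Var i - Const (\<mu> i)"
proof -
  have "shifted_monomial (Poly_Mapping.single i 1) =
      (\<Prod>j\<in>UNIV. if i = j then Var j - Const (\<mu> j) else 1)"
    unfolding shifted_monomial_def by (intro prod.cong refl) (auto simp: lookup_single when_def)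
  then show ?thesis by simp
qed

definition nilpotency_bound :: nat where
  "nilpotency_bound = (SOME N. N > 0 \<and> (\<forall>i v. s ((Var i - Const (\<mu> i)) ^ N) v = 0))"

text \<open>
  Exponents outside the box contain a power of some \<open>x\<^sub>i - \<mu>\<^sub>i\<close> that acts as zero.
\<close>

definition box :: "'n mon set" where
  "box = {a. \<forall>i. Poly_Mapping.lookup a i < nilpotency_bound}"

lemma nilpotency_bound:
  "nilpotency_bound > 0" "s ((Var i - Const (\<mu> i)) ^ nilpotency_bound) v = 0"
proof -
  obtain k where k: "\<And>i v. s ((Var i - Const (\<mu> i)) ^ k i) v = 0"
    using shifted_variable_nilpotent by metis
  let ?N = "Suc (\<Sum>i\<in>UNIV. k i)"
  have "s ((Var i - Const (\<mu> i)) ^ ?N) v = 0" for i v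
  proof -
    have "k i \<le> (\<Sum>i\<in>UNIV. k i)" by (rule member_le_sum) simp_all
    then have "?N = (?N - k i) + k i" by simp
    then have "s ((Var i - Const (\<mu> i)) ^ ?N) v =
        s ((Var i - Const (\<mu> i)) ^ (?N - k i)) (s ((Var i - Const (\<mu> i)) ^ k i) v)"
      by (metis power_add scale_scale)
    then show ?thesis by (simp add: k)
  qed
  then have "?N > 0 \<and> (\<forall>i v. s ((Var i - Const (\<mu> i)) ^ ?N) v = 0)" by blast
  then have "nilpotency_bound > 0 \<and> (\<forall>i v. s ((Var i - Const (\<mu> i)) ^ nilpotency_bound) v = 0)"
    unfolding nilpotency_bound_def by (rule someI)
  then show "nilpotency_bound > 0" "s ((Var i - Const (\<mu> i)) ^ nilpotency_bound) v = 0"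
    by blast+
qed

lemma shifted_monomial_vanishing:
  assumes "a \<notin> box"
  shows "s (shifted_monomial a) v = 0"
proof -
  obtain i where i: "nilpotency_bound \<le> Poly_Mapping.lookup a i"
    using assms by (auto simp: box_def not_less)
  let ?y = "\<lambda>j. (Var j - Const (\<mu> j)) ^ Poly_Mapping.lookup a j"
  have "shifted_monomial a = (\<Prod>j\<in>UNIV - {i}. ?y j) * ?y i"
    unfolding shifted_monomial_def by (subst prod.remove[of UNIV i]) (simp_all add: mult.commute)
  also have "?y i = (Var i - Const (\<mu> i)) ^ (Poly_Mapping.lookup a i - nilpotency_bound) *
      (Var i - Const (\<mu> i)) ^ nilpotency_bound"
    using i by (simp flip: power_add)
  finally show ?thesis
    by (simp add: scale_scale[symmetric] nilpotency_bound)
qed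

lemma shifted_monomial_v\<^sub>0:
  assumes "a \<noteq> 0"
  shows "s (shifted_monomial a) v\<^sub>0 = 0"
  using assms
proof (induction a rule: mon_induct)
  case (add_var a i)
  have "s (Var i - Const (\<mu> i)) v\<^sub>0 = 0"
    using eigenvector by (simp add: scale_left_diff_distrib)
  then show ?case
    by (simp add: shifted_monomial_add shifted_monomial_single scale_scale[symmetric] del: One_nat_def)
qed simp

sublocale locally_nilpotent_module s shifted_monomial
proof unfold_locales
  show "shifted_monomial 0 = 1" by (rule shifted_monomial_zero)
  show "shifted_monomial (a + b) = shifted_monomial a * shifted_monomial b" for a b
    by (rule shifted_monomial_add)
  show "finite {a. s (shifted_monomial a) v \<noteq> 0}" for v
    by (rule finite_subset[OF _ finite_mon_box[of nilpotency_bound]])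
      (use shifted_monomial_vanishing[of _ v] in \<open>auto simp: box_def\<close>)
qed

text \<open>
  The polynomials that act like power series in the \<open>x\<^sub>i - \<mu>\<^sub>i\<close> form a subalgebra which contains
  the constants and the variables.
\<close>

lemma polynomial_eq_ev: "\<exists>f. \<forall>v. s p v = ev f v"
proof -
  let ?R = "\<lambda>p. \<exists>f. \<forall>v. s p v = ev f v"
  have const: "?R (Const c)" for c
    by (rule exI[of _ "\<lambda>a. if a = 0 then c else 0"])
      (subst ev_single[of 0], auto simp: shifted_monomial_zero)
  have add: "?R (p + q)" if "?R p" "?R q" for p q
  proof -
    from that obtain f g where "\<And>v. s p v = ev f v" "\<And>v. s q v = ev g v" by blast
    then show ?thesis
      by (intro exI[of _ "\<lambda>a. f a + g a"]) (simp add: scale_left_distrib ev_series_add)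
  qed
  have mult: "?R (p * q)" if "?R p" "?R q" for p q
  proof -
    from that obtain f g where "\<And>v. s p v = ev f v" "\<And>v. s q v = ev g v" by blast
    then show ?thesis
      by (intro exI[of _ "f \<star> g"]) (simp add: scale_scale[symmetric] ev_mult)
  qed
  have shifted: "?R (Var i - Const (\<mu> i))" for i
    by (rule exI[of _ "\<lambda>a. if a = Poly_Mapping.single i 1 then 1 else 0"])
      (subst ev_single[of "Poly_Mapping.single i 1"], auto simp: shifted_monomial_single simp del: One_nat_def)
  have var: "?R (Var i)" for i
    using add[OF shifted[of i] const[of "\<mu> i"]] by simp
  have mono: "?R (monomial a)" for a
  proof (induction a rule: mon_induct)
    case zero
    show ?case using const[of 1] by (simp add: monomial_def)
  next
    case (add_var a i)
    have "monomial (a + Poly_Mapping.single i 1) = (monomial a * Var i :: ('n, 'k) mpol)"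
      by (simp add: monomial_def Var_def mult_single)
    then show ?case using mult[OF add_var var] by simp
  qed
  have "?R (\<Sum>a\<in>A. Const (Poly_Mapping.lookup p a) * monomial a)" if "finite A" for A
    using that
  proof (induction rule: finite_induct)
    case empty
    show ?case using const[of 0] by simp
  next
    case (insert a A)
    then show ?case using add[OF mult[OF const mono] insert.IH] by simp
  qed
  from this[OF finite_keys[of p]] show ?thesis
    by (simp add: Const_def monomial_def mult_single flip: mpol_eq_sum_single)
qed

lemma exists_functional_one_at_v\<^sub>0:
  "\<exists>\<psi> :: 'm \<Rightarrow> 'k. (\<forall>u v. \<psi> (u + v) = \<psi> u + \<psi> v) \<and>
     (\<forall>c v. \<psi> (s (Const c) v) = c * \<psi> v) \<and> \<psi> v\<^sub>0 = 1"
proof -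
  have ind: "\<not> K.dependent {v\<^sub>0}" using v\<^sub>0_nonzero by simp
  let ?S = "K.extend_basis {v\<^sub>0}"
  have S: "\<not> K.dependent ?S" "K.span ?S = UNIV" "v\<^sub>0 \<in> ?S"
    using K.independent_extend_basis[OF ind] K.span_extend_basis[OF ind]
      K.extend_basis_superset[OF ind] by blast+
  show ?thesis
  proof (intro exI[of _ "\<lambda>v. K.representation ?S v v\<^sub>0"] conjI allI)
    show "K.representation ?S (u + v) v\<^sub>0 = K.representation ?S u v\<^sub>0 + K.representation ?S v v\<^sub>0" for u v
      using S by (simp add: K.representation_add)
    show "K.representation ?S (s (Const c) v) v\<^sub>0 = c * K.representation ?S v v\<^sub>0" for c v
      using K.representation_scale[OF S(1), of v c] S(2) by (simp add: kscale_def)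
    show "K.representation ?S v\<^sub>0 v\<^sub>0 = 1"
      using S by (simp add: K.representation_basis)
  qed
qed

text \<open>
  The functionals \<open>v \<mapsto> \<psi>(p v)\<close> separate vectors, because the submodule generated by a nonzero
  \<open>v\<close> contains \<open>v\<^sub>0\<close>. Hence \<open>\<psi> \<circ> \<phi>\<close> is one of them, say \<open>\<psi>(\<phi> v) = \<psi>(p v)\<close>. Replacing
  \<open>v\<close> by \<open>q v\<close> shows that no functional of this form distinguishes \<open>\<phi> v\<close> from \<open>p v\<close>.
\<close>

lemma endomorphism_eq_polynomial:
  assumes \<phi>: "\<phi> \<in> mod_End s UNIV"
  shows "\<exists>p. \<forall>v. \<phi> v = s p v"
proof -
  have \<phi>_add: "\<phi> (u + v) = \<phi> u + \<phi> v" and \<phi>_scale: "\<phi> (s p v) = s p (\<phi> v)" for u v p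
    using \<phi> by (auto simp: mod_End_def)
  obtain \<psi> :: "'m \<Rightarrow> 'k" where \<psi>_add: "\<And>u v. \<psi> (u + v) = \<psi> u + \<psi> v"
    and \<psi>_scale: "\<And>c v. \<psi> (s (Const c) v) = c * \<psi> v" and \<psi>_v\<^sub>0: "\<psi> v\<^sub>0 = 1"
    using exists_functional_one_at_v\<^sub>0 by blast
  have separating: "\<exists>p. \<psi> (s p v) \<noteq> 0" if "v \<noteq> 0" for v
  proof -
    have "subspace (range (\<lambda>p. s p v))"
    proof (rule subspaceI)
      show "0 \<in> range (\<lambda>p. s p v)" by (rule range_eqI[of _ _ 0]) simp
      show "u + w \<in> range (\<lambda>p. s p v)" if "u \<in> range (\<lambda>p. s p v)" "w \<in> range (\<lambda>p. s p v)" for u w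
        using that by (auto simp flip: scale_left_distrib)
      show "s q u \<in> range (\<lambda>p. s p v)" if "u \<in> range (\<lambda>p. s p v)" for q u
        using that by (auto simp: scale_scale)
    qed
    moreover have "v \<in> range (\<lambda>p. s p v)" by (rule range_eqI[of _ _ 1]) simp
    ultimately have "v\<^sub>0 \<in> range (\<lambda>p. s p v)" using essential that by blast
    then obtain p where "v\<^sub>0 = s p v" by blast
    then show ?thesis using \<psi>_v\<^sub>0 by (intro exI[of _ p]) simp
  qed
  obtain S where S: "finite S" "\<not> K.dependent S" "K.span S = UNIV"
    by (rule finite_basis)
  let ?E = "range (\<lambda>p v. \<psi> (s p v))"
  have "\<exists>e\<in>?E. \<forall>x\<in>S. e x = \<psi> (\<phi> x)"
  proof (rule K.separating_functionals_interpolate)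
    show "(\<lambda>_. 0) \<in> ?E"
      using \<psi>_scale[of 0] by (intro range_eqI[of _ _ 0]) simp
    show "(\<lambda>v. e v + f v) \<in> ?E" if "e \<in> ?E" "f \<in> ?E" for e f
    proof -
      from that obtain p q where "e = (\<lambda>v. \<psi> (s p v))" "f = (\<lambda>v. \<psi> (s q v))" by blast
      then show ?thesis by (intro range_eqI[of _ _ "p + q"]) (simp add: scale_left_distrib \<psi>_add)
    qed
    show "(\<lambda>v. c * e v) \<in> ?E" if "e \<in> ?E" for c e
    proof -
      from that obtain p where "e = (\<lambda>v. \<psi> (s p v))" by blast
      then show ?thesis
        by (intro range_eqI[of _ _ "Const c * p"]) (simp add: scale_scale[symmetric] \<psi>_scale)
    qed
    show "e (u + v) = e u + e v" if "e \<in> ?E" for e u v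
      using that by (auto simp: scale_right_distrib \<psi>_add)
    show "e (kscale s c v) = c * e v" if "e \<in> ?E" for e c v
      using that by (auto simp: kscale_def scale_left_commute[of _ "Const c"] \<psi>_scale)
    show "\<exists>e\<in>?E. e v \<noteq> 0" if nonzero: "v \<noteq> 0" for v
    proof -
      obtain p where "\<psi> (s p v) \<noteq> 0" using separating[OF nonzero] by (rule exE)
      then show ?thesis by (intro bexI[of _ "\<lambda>v. \<psi> (s p v)"] rangeI)
    qed
    show "finite S" "\<not> K.dependent S" by (fact S)+
  qed
  then obtain p where p: "\<And>x. x \<in> S \<Longrightarrow> \<psi> (s p x) = \<psi> (\<phi> x)" by auto
  have agree: "\<psi> (s p v) = \<psi> (\<phi> v)" for v
  proof -
    have "v \<in> K.span S" using S by simp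
    then show ?thesis
    proof (induction rule: K.span_induct_alt)
      case base
      show ?case using \<phi>_scale[of 0 0] by simp
    next
      case (step c x y)
      then show ?case
        using p[of x] by (simp add: kscale_def scale_right_distrib \<phi>_add \<psi>_add \<phi>_scale \<psi>_scale
            scale_left_commute[of p])
    qed
  qed
  have "\<phi> v = s p v" for v
  proof (rule ccontr)
    assume "\<phi> v \<noteq> s p v"
    then obtain q where q: "\<psi> (s q (\<phi> v - s p v)) \<noteq> 0" using separating[of "\<phi> v - s p v"] by auto
    have "\<psi> (s q (\<phi> v)) = \<psi> (s q (s p v))"
      using agree[of "s q v"] by (simp add: \<phi>_scale scale_left_commute[of q])
    moreover have "s q (\<phi> v) = s q (\<phi> v - s p v) + s q (s p v)"
      by (simp add: scale_right_diff_distrib)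
    ultimately show False using q \<psi>_add by (metis add_cancel_right_left)
  qed
  then show ?thesis by blast
qed

end

text \<open>
  A nonzero submodule of least dimension inside \<open>W\<close> is minimal, so it is contained in the
  socle and, the socle being a line, equal to it. The socle is a submodule; this makes its
  generator an eigenvector of every variable.
\<close>

lemma one_dim_socle_essential_line:
  fixes s :: "('n::finite, 'k::field) mpol \<Rightarrow> 'm::ab_group_add \<Rightarrow> 'm"
  assumes "Modules.module s" "fin_dim s UNIV" "kdim s (Soc s) = 1"
  obtains v\<^sub>0 \<mu> where "essential_line_module s v\<^sub>0 \<mu>"
proof -
  interpret Modules.module s by fact
  interpret K: vector_space "kscale s" by (rule vector_space_kscale) fact
  obtain A where A: "finite A" "K.span A = UNIV"
    using assms(2) by (auto simp: fin_dim_def)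
  obtain S where S: "S \<subseteq> A" "\<not> K.dependent S" "A \<subseteq> K.span S"
    by (rule K.maximal_independent_subset)
  have "K.span A \<subseteq> K.span S" by (rule K.span_minimal[OF S(3) K.subspace_span])
  then interpret K: finite_dimensional_vector_space "kscale s" S
    using A S finite_subset[OF S(1)] by unfold_locales auto
  have K_subspace: "K.subspace W" if "subspace W" for W
    using that by (auto simp: subspace_def K.subspace_def kscale_def)
  obtain T where T: "T \<subseteq> Soc s" "\<not> K.dependent T" "Soc s \<subseteq> K.span T" "card T = K.dim (Soc s)"
    by (rule K.basis_exists)
  then obtain v\<^sub>0 where v\<^sub>0: "T = {v\<^sub>0}"
    using assms(3) by (auto simp: kdim_def card_1_singleton_iff)
  have multiple: "\<exists>c. v = s (Const c) v\<^sub>0" if "v \<in> Soc s" for v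
    using that T(3) by (auto simp: v\<^sub>0 K.span_singleton kscale_def)
  have "v\<^sub>0 \<noteq> 0" using T(2) by (simp add: v\<^sub>0)
  have Soc: "subspace (Soc s)" unfolding Soc_def by (rule subspace_span)
  have "v\<^sub>0 \<in> W" if W: "subspace W" "W \<noteq> {0}" for W
  proof -
    let ?P = "\<lambda>N. subspace N \<and> N \<subseteq> W \<and> N \<noteq> {0}"
    obtain N where N: "?P N" "\<And>N'. ?P N' \<Longrightarrow> K.dim N \<le> K.dim N'"
      using ex_has_least_nat[of ?P W K.dim] W by blast
    have "minimal_submodule s N"
      unfolding minimal_submodule_def
    proof (intro conjI allI impI)
      fix N' assume N': "subspace N' \<and> N' \<subseteq> N"
      show "N' = {0} \<or> N' = N"
      proof (cases "N' = {0}")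
        case False
        then have "K.dim N \<le> K.dim N'" using N N' by blast
        then show ?thesis
          using K.subspace_dim_equal[of N' N] K_subspace N N' by blast
      qed simp
    qed (use N in auto)
    then have "N \<subseteq> Soc s"
      unfolding Soc_def by (intro subset_trans[OF _ span_superset] Union_upper) simp
    moreover obtain v where v: "v \<in> N" "v \<noteq> 0"
      using N(1) subspace_0[of N] by blast
    ultimately obtain c where c: "v = s (Const c) v\<^sub>0" using multiple by blast
    then have "c \<noteq> 0" using v by auto
    then have "s (Const (inverse c)) v = v\<^sub>0"
      by (simp add: c flip: Const_mult)
    then have "v\<^sub>0 \<in> N" using subspace_scale[of N v "Const (inverse c)"] N(1) v(1) by simp
    then show ?thesis using N(1) by blast
  qed
  moreover have "\<exists>c. s (Var i) v\<^sub>0 = s (Const c) v\<^sub>0" for i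
    using T(1) by (intro multiple subspace_scale[OF Soc]) (simp add: v\<^sub>0)
  then obtain \<mu> where "\<And>i. s (Var i) v\<^sub>0 = s (Const (\<mu> i)) v\<^sub>0" by metis
  ultimately have "essential_line_module s v\<^sub>0 \<mu>"
    using assms(2) \<open>v\<^sub>0 \<noteq> 0\<close> by unfold_locales
  then show ?thesis by (rule that)
qed

text \<open>
  A power series acts on \<open>v\<^sub>0\<close> as its constant term, so automorphisms come from power series
  with nonzero constant term, and these are in the image of \<open>K_grp_action\<close>.
\<close>

theorem Aut_one_dim_socle:
  fixes s :: "('n::finite, 'k::field_char_0) mpol \<Rightarrow> 'm::ab_group_add \<Rightarrow> 'm"
  assumes "Modules.module s" "fin_dim s UNIV" "kdim s (Soc s) = 1"
  shows "\<exists>m N. N \<lhd> (K_grp m :: ('k \<times> (nat \<Rightarrow> 'k)) monoid) \<and> mod_AutGroup s UNIV \<cong> K_grp m Mod N"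
proof -
  obtain v\<^sub>0 \<mu> where "essential_line_module s v\<^sub>0 \<mu>"
    using one_dim_socle_essential_line[OF assms] .
  then interpret essential_line_module s v\<^sub>0 \<mu> .
  have fin: "finite box" unfolding box_def by (rule finite_mon_box)
  have zero: "0 \<in> box" using nilpotency_bound(1) by (simp add: box_def)
  have divisors: "a \<in> box" if "a + b \<in> box" for a b
    unfolding box_def
  proof (intro CollectI allI)
    fix i
    have "Poly_Mapping.lookup a i + Poly_Mapping.lookup b i < nilpotency_bound"
      using that by (simp add: box_def lookup_add)
    then show "Poly_Mapping.lookup a i < nilpotency_bound" by simp
  qed
  have "card (box - {0}) = card box - 1" using zero by (rule card_Diff_singleton)
  then obtain idx where idx: "bij_betw idx (box - {0}) {..<card box - 1}"
    using fin ex_bij_betw_finite_nat[of "box - {0}"] by (auto simp: atLeast0LessThan)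
  interpret W: finite_support_submodule s shifted_monomial UNIV box idx
    by unfold_locales (use zero idx shifted_monomial_vanishing in auto)
  let ?K = "K_grp (card box - 1) :: ('k \<times> (nat \<Rightarrow> 'k)) monoid"
  let ?A = "mod_AutGroup s UNIV"
  interpret hom: group_hom ?K ?A W.K_grp_action
    by (intro group_hom.intro group_hom_axioms.intro group_K_grp group_mod_AutGroup W.K_grp_action_hom
        module_axioms subspace_UNIV)
  have "W.K_grp_action ` carrier ?K = carrier ?A"
  proof (intro equalityI subsetI)
    fix \<phi> assume phi: "\<phi> \<in> carrier ?A"
    then have End: "\<phi> \<in> mod_End s UNIV" and inj: "inj \<phi>"
      by (auto simp: mod_AutGroup_def Bij_def bij_betw_def)
    obtain p where "\<And>v. \<phi> v = s p v" using endomorphism_eq_polynomial[OF End] by blast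
    moreover obtain f where "\<And>v. s p v = ev f v" using polynomial_eq_ev[of p] by blast
    ultimately have f: "\<phi> v = ev f v" for v by simp
    have "f 0 \<noteq> 0"
    proof
      assume "f 0 = 0"
      then have "\<phi> v\<^sub>0 = 0"
        unfolding f by (subst ev_single[of 0]) (use shifted_monomial_v\<^sub>0 in auto)
      moreover have "\<phi> 0 = 0" by (simp add: f ev_def)
      ultimately show False using inj v\<^sub>0_nonzero by (auto simp: inj_def)
    qed
    then have "restrict (ev f) UNIV \<in> W.K_grp_action ` carrier ?K"
      using divisors by (rule W.ev_in_range_K_grp_action)
    moreover have "restrict (ev f) UNIV = \<phi>" by (simp add: fun_eq_iff f)
    ultimately show "\<phi> \<in> W.K_grp_action ` carrier ?K" by simp
  qed (use W.K_grp_action_hom in \<open>auto simp: hom_def\<close>)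
  then have "?K Mod kernel ?K ?A W.K_grp_action \<cong> ?A"
    using hom.FactGroup_iso_set by (auto simp: is_iso_def)
  then have "?A \<cong> ?K Mod kernel ?K ?A W.K_grp_action"
    by (rule group.iso_sym[OF normal.factorgroup_is_group[OF hom.normal_kernel]])
  with hom.normal_kernel show ?thesis
    by (intro exI conjI)
qed


section \<open>Endomorphisms and automorphisms\<close>

theorem theorem4:
  shows "(alg_isomorphic
             (mod_End_algebra (Tn :: ('n::finite, 'k::{alg_closed_field, field_char_0}) mpol \<Rightarrow> _) UNIV)
             (mps_algebra :: ('k, 'n mon \<Rightarrow> 'k) module)
          \<and> mod_AutGroup (Tn :: ('n, 'k) mpol \<Rightarrow> _) UNIV
             \<cong> units_of (mps_algebra :: ('k, 'n mon \<Rightarrow> 'k) module))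
    \<and> (\<forall>(M :: ('n, 'k) mpol set) m.
          monomial_submodule M \<and> fin_dim Tn M \<and> kdim Tn M = m \<and> m \<ge> 1 \<longrightarrow>
          mod_AutGroup Tn M \<cong> (K_grp (m - 1) :: ('k \<times> (nat \<Rightarrow> 'k)) monoid))
    \<and> (\<forall>act :: ('n, 'k) mpol \<Rightarrow> 'v::ab_group_add \<Rightarrow> 'v.
          Modules.module act \<and> fin_dim act UNIV \<and> kdim act (Soc act) = 1 \<longrightarrow>
          (\<exists>m N. N \<lhd> (K_grp m :: ('k \<times> (nat \<Rightarrow> 'k)) monoid) \<and>
             mod_AutGroup act UNIV \<cong> K_grp m Mod N))"
proof (intro conjI allI impI; (elim conjE)?)
  show "alg_isomorphic (mod_End_algebra (Tn :: ('n, 'k) mpol \<Rightarrow> _) UNIV)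
      (mps_algebra :: ('k, 'n mon \<Rightarrow> 'k) module)"
    by (rule End_Tn_isomorphic)
  show "mod_AutGroup (Tn :: ('n, 'k) mpol \<Rightarrow> _) UNIV
      \<cong> units_of (mps_algebra :: ('k, 'n mon \<Rightarrow> 'k) module)"
    by (rule Aut_Tn_isomorphic)
qed (rule Aut_monomial_submodule_isomorphic Aut_one_dim_socle; assumption)+

end
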